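(* Let $\nu$ be a positive integer, let $\mathcal D_\nu$ be the Lie algebra of differential operators on $\mathbb C[t_1^{\pm1},\ldots,t_\nu^{\pm1}]$, and let $\mathfrak h_\nu=\mathrm{span}_{\mathbb C}\{D_1,\ldots,D_\nu\}$. Let $M$ be a $\mathcal D_\nu$-module which is free of rank $1$ as a $U(\mathfrak h_\nu)$-module. Then $M\cong\Omega(\Lambda,\epsilon)$ as $\mathcal D_\nu$-modules for some $\Lambda\in(\mathbb C^* )^\nu$ and some $\epsilon\in\{0,1\}$.
   Context: All algebras and modules are over $\mathbb C$; $\mathbb N$ denotes the non-negative integers and $\mathbb C^*=\mathbb C\setminus\{0\}$. For $\underline m=(m_1,\ldots,m_\nu)\in\mathbb Z^\nu$ and $\underline n=(n_1,\ldots,n_\nu)\in\mathbb N^\nu$ put $t^{\underline m}=t_1^{m_1}\cdots t_\nu^{m_\nu}$ and $D^{\underline n}=D_1^{n_1}\cdots D_\nu^{n_\nu}$, where $D_i=t_i\frac{\partial}{\partial t_i}$. $\mathcal D_\nu$ is the associative algebra of differential operators on $\mathbb C[t_1^{\pm1},\ldots,t_\nu^{\pm1}]$, which has basis $\{t^{\underline m}D^{\underline n}\mid \underline m\in\mathbb Z^\nu,\underline n\in\mathbb N^\nu\}$, regarded as a Lie algebra under the commutator; the associative product is $$(t^{\underline r}D^{\underline m})(t^{\underline s}D^{\underline n})=\sum_{i_1=0}^{m_1}\cdots\sum_{i_\nu=0}^{m_\nu}\binom{m_1}{i_1}\cdots\binom{m_\nu}{i_\nu}s_1^{i_1}\cdots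 s_\nu^{i_\nu}\,t^{\underline r+\underline s}D^{\underline m+\underline n-\underline i}$$ (with $0^0=1$). $\mathfrak h_\nu$ is an abelian Lie subalgebra, and $U(\mathfrak h_\nu)$ is its universal enveloping algebra, acting on $M$ through the Lie algebra elements $D_1,\dots,D_\nu$. For $\Lambda=(\lambda_1,\ldots,\lambda_\nu)\in(\mathbb C^* )^\nu$ and $\epsilon\in\{0,1\}$, $\Omega(\Lambda,\epsilon)$ is the $\mathcal D_\nu$-module with underlying space $\mathbb C[x_1,\ldots,x_\nu]$ and action $$t^{\underline m}D^{\underline n}\cdot f(x_1,\ldots,x_\nu)=\beta^{1-\sum_{i=1}^\nu n_i}\,\Lambda^{\underline m}\prod_{j=1}^\nu(x_j-\epsilon m_j)^{n_j}\,f(x_1-m_1,\ldots,x_\nu-m_\nu),$$ where $\beta=(-1)^{1-\epsilon}$ and $\Lambda^{\underline m}=\lambda_1^{m_1}\cdots\lambda_\nu^{m_\nu}$, for $f\in\mathbb C[x_1,\ldots,x_\nu]$. *)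

theory Defs
  imports "HOL-Analysis.Analysis" "HOL-Library.Poly_Mapping" "HOL-Library.Function_Algebras"
begin

section \<open>Complex Lie algebras and their modules\<close>

text \<open>Lie algebras are carrier sets inside an ambient complex vector space, so that a subalgebra
  such as the Cartan subalgebra below shares its type and bracket with the whole algebra.\<close>

locale lie_algebra = vector_space smul
  for smul :: "complex \<Rightarrow> 'a::ab_group_add \<Rightarrow> 'a" +
  fixes \<gg> :: "'a set"
    and bracket :: "'a \<Rightarrow> 'a \<Rightarrow> 'a"
  assumes subspace_carrier: "subspace \<gg>"
    and bracket_closed: "x \<in> \<gg> \<Longrightarrow> y \<in> \<gg> \<Longrightarrow> bracket x y \<in> \<gg>"
    and bracket_add_left:
      "x \<in> \<gg> \<Longrightarrow> y \<in> \<gg> \<Longrightarrow> z \<in> \<gg> \<Longrightarrow> bracket (x + y) z = bracket x z + bracket y z"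
    and bracket_add_right:
      "x \<in> \<gg> \<Longrightarrow> y \<in> \<gg> \<Longrightarrow> z \<in> \<gg> \<Longrightarrow> bracket x (y + z) = bracket x y + bracket x z"
    and bracket_scale_left:
      "x \<in> \<gg> \<Longrightarrow> y \<in> \<gg> \<Longrightarrow> bracket (smul c x) y = smul c (bracket x y)"
    and bracket_scale_right:
      "x \<in> \<gg> \<Longrightarrow> y \<in> \<gg> \<Longrightarrow> bracket x (smul c y) = smul c (bracket x y)"
    and bracket_self: "x \<in> \<gg> \<Longrightarrow> bracket x x = 0"
    and jacobi: "x \<in> \<gg> \<Longrightarrow> y \<in> \<gg> \<Longrightarrow> z \<in> \<gg> \<Longrightarrow>
      bracket x (bracket y z) + bracket y (bracket z x) + bracket z (bracket x y) = 0"

locale lie_module = lie_algebra smul \<gg> bracket + M: vector_space scaleM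
  for smul :: "complex \<Rightarrow> 'a::ab_group_add \<Rightarrow> 'a"
    and \<gg> :: "'a set"
    and bracket :: "'a \<Rightarrow> 'a \<Rightarrow> 'a"
    and scaleM :: "complex \<Rightarrow> 'm::ab_group_add \<Rightarrow> 'm" +
  fixes act :: "'a \<Rightarrow> 'm \<Rightarrow> 'm"
  assumes act_add_left: "x \<in> \<gg> \<Longrightarrow> y \<in> \<gg> \<Longrightarrow> act (x + y) v = act x v + act y v"
    and act_scale_left: "x \<in> \<gg> \<Longrightarrow> act (smul c x) v = scaleM c (act x v)"
    and act_add_right: "x \<in> \<gg> \<Longrightarrow> act x (v + w) = act x v + act x w"
    and act_scale_right: "x \<in> \<gg> \<Longrightarrow> act x (scaleM c v) = scaleM c (act x v)"
    and act_bracket: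
      "x \<in> \<gg> \<Longrightarrow> y \<in> \<gg> \<Longrightarrow> act (bracket x y) v = act x (act y v) - act y (act x v)"

definition lie_module_isomorphic ::
    "'a set \<Rightarrow> (complex \<Rightarrow> 'm::ab_group_add \<Rightarrow> 'm) \<Rightarrow> ('a \<Rightarrow> 'm \<Rightarrow> 'm)
      \<Rightarrow> (complex \<Rightarrow> 'w::ab_group_add \<Rightarrow> 'w) \<Rightarrow> ('a \<Rightarrow> 'w \<Rightarrow> 'w) \<Rightarrow> bool" where
  "lie_module_isomorphic \<gg> scaleM actM scaleN actN \<longleftrightarrow>
    (\<exists>\<phi>. Vector_Spaces.linear scaleM scaleN \<phi> \<and> bij \<phi> \<and>
      (\<forall>x\<in>\<gg>. \<forall>v. \<phi> (actM x v) = actN x (\<phi> v)))"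


section \<open>The universal enveloping algebra\<close>

text \<open>Words in the elements of \<^typ>\<open>'a\<close> form a free monoid, written additively as
  \<^theory>\<open>HOL-Library.Poly_Mapping\<close> requires of an index monoid; the type
  \<open>'a word \<Rightarrow>\<^sub>0 complex\<close> is then the free associative unital algebra on the set of all
  elements of \<^typ>\<open>'a\<close>, with concatenation of words as multiplication.\<close>

datatype 'a word = Word (letters: "'a list")

instantiation word :: (type) monoid_add
begin

definition zero_word :: "'a word" where
  "0 = Word []"

definition plus_word :: "'a word \<Rightarrow> 'a word \<Rightarrow> 'a word" where
  "u + w = Word (letters u @ letters w)"

instance
  by standard (auto simp: zero_word_def plus_word_def)

end

definition pm_scale :: "complex \<Rightarrow> ('k \<Rightarrow>\<^sub>0 complex) \<Rightarrow> ('k \<Rightarrow>\<^sub>0 complex)" where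
  "pm_scale c p = Poly_Mapping.map ((*) c) p"

lemma lookup_pm_scale [simp]:
  "Poly_Mapping.lookup (pm_scale c p) k = c * Poly_Mapping.lookup p k"
  by (simp add: pm_scale_def Poly_Mapping.map.rep_eq when_def)

global_interpretation pm: vector_space pm_scale
  by standard (auto intro!: poly_mapping_eqI simp: lookup_add algebra_simps)

lemma pm_expand:
  "p = (\<Sum>w\<in>Poly_Mapping.keys p. Poly_Mapping.single w (Poly_Mapping.lookup p w))"
  for p :: "'k \<Rightarrow>\<^sub>0 complex"
  by (rule poly_mapping_eqI)
    (auto simp: lookup_sum lookup_single when_def in_keys_iff)

definition free_alg :: "'a set \<Rightarrow> ('a word \<Rightarrow>\<^sub>0 complex) set" where
  "free_alg \<gg> = {p. \<forall>w\<in>Poly_Mapping.keys p. set (letters w) \<subseteq> \<gg>}"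

definition gen :: "'a \<Rightarrow> ('a word \<Rightarrow>\<^sub>0 complex)" where
  "gen x = Poly_Mapping.single (Word [x]) 1"

text \<open>The relations \<open>gen_add\<close> and \<open>gen_scale\<close> turn the free algebra on the set \<open>\<gg>\<close> into the
  tensor algebra of the vector space \<open>\<gg>\<close>.\<close>

inductive_set uea_ideal ::
    "(complex \<Rightarrow> 'a \<Rightarrow> 'a) \<Rightarrow> 'a set \<Rightarrow> ('a \<Rightarrow> 'a \<Rightarrow> 'a) \<Rightarrow> ('a::ab_group_add word \<Rightarrow>\<^sub>0 complex) set"
  for smul :: "complex \<Rightarrow> 'a \<Rightarrow> 'a" and \<gg> :: "'a set" and bracket :: "'a \<Rightarrow> 'a \<Rightarrow> 'a" where
  zero: "0 \<in> uea_ideal smul \<gg> bracket"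
| add: "p \<in> uea_ideal smul \<gg> bracket \<Longrightarrow> q \<in> uea_ideal smul \<gg> bracket \<Longrightarrow>
    p + q \<in> uea_ideal smul \<gg> bracket"
| mult: "p \<in> uea_ideal smul \<gg> bracket \<Longrightarrow> a \<in> free_alg \<gg> \<Longrightarrow> b \<in> free_alg \<gg> \<Longrightarrow>
    a * p * b \<in> uea_ideal smul \<gg> bracket"
| gen_add: "x \<in> \<gg> \<Longrightarrow> y \<in> \<gg> \<Longrightarrow> gen (x + y) - gen x - gen y \<in> uea_ideal smul \<gg> bracket"
| gen_scale: "x \<in> \<gg> \<Longrightarrow> gen (smul c x) - pm_scale c (gen x) \<in> uea_ideal smul \<gg> bracket"
| gen_bracket: "x \<in> \<gg> \<Longrightarrow> y \<in> \<gg> \<Longrightarrow>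
    gen x * gen y - gen y * gen x - gen (bracket x y) \<in> uea_ideal smul \<gg> bracket"

definition uea ::
    "(complex \<Rightarrow> 'a \<Rightarrow> 'a) \<Rightarrow> 'a set \<Rightarrow> ('a \<Rightarrow> 'a \<Rightarrow> 'a) \<Rightarrow> ('a::ab_group_add word \<Rightarrow>\<^sub>0 complex) set set"
  where
  "uea smul \<gg> bracket = free_alg \<gg> //
    {(p, q). p \<in> free_alg \<gg> \<and> q \<in> free_alg \<gg> \<and> p - q \<in> uea_ideal smul \<gg> bracket}"

text \<open>A word \<open>x\<^sub>1 \<dots> x\<^sub>k\<close> acts as the composite of the actions of its letters.\<close>

definition free_act ::
    "(complex \<Rightarrow> 'm \<Rightarrow> 'm) \<Rightarrow> ('a \<Rightarrow> 'm \<Rightarrow> 'm) \<Rightarrow> ('a word \<Rightarrow>\<^sub>0 complex) \<Rightarrow> 'm::ab_group_add \<Rightarrow> 'm" where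
  "free_act scaleM act p v =
    (\<Sum>w\<in>Poly_Mapping.keys p. scaleM (Poly_Mapping.lookup p w) (foldr act (letters w) v))"

text \<open>The common value on all representatives of the class \<open>u\<close>; see
  \<open>lie_module.uea_act_class\<close> below.\<close>

definition uea_act ::
    "(complex \<Rightarrow> 'm \<Rightarrow> 'm) \<Rightarrow> ('a \<Rightarrow> 'm \<Rightarrow> 'm) \<Rightarrow> ('a word \<Rightarrow>\<^sub>0 complex) set \<Rightarrow> 'm::ab_group_add \<Rightarrow> 'm" where
  "uea_act scaleM act u v = the_elem ((\<lambda>p. free_act scaleM act p v) ` u)"

definition uea_free_rank_one ::
    "(complex \<Rightarrow> 'a::ab_group_add \<Rightarrow> 'a) \<Rightarrow> 'a set \<Rightarrow> ('a \<Rightarrow> 'a \<Rightarrow> 'a)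
      \<Rightarrow> (complex \<Rightarrow> 'm \<Rightarrow> 'm) \<Rightarrow> ('a \<Rightarrow> 'm::ab_group_add \<Rightarrow> 'm) \<Rightarrow> bool" where
  "uea_free_rank_one smul \<gg> bracket scaleM act \<longleftrightarrow>
    (\<exists>v. bij_betw (\<lambda>u. uea_act scaleM act u v) (uea smul \<gg> bracket) UNIV)"

lemma free_alg_gen: "x \<in> \<gg> \<Longrightarrow> gen x \<in> free_alg \<gg>"
  by (auto simp: free_alg_def gen_def)

lemma free_alg_add: "p \<in> free_alg \<gg> \<Longrightarrow> q \<in> free_alg \<gg> \<Longrightarrow> p + q \<in> free_alg \<gg>"
  using Poly_Mapping.keys_add[of p q] by (auto simp: free_alg_def)

lemma free_alg_uminus: "p \<in> free_alg \<gg> \<Longrightarrow> - p \<in> free_alg \<gg>"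
  by (auto simp: free_alg_def in_keys_iff)

lemma free_alg_diff: "p \<in> free_alg \<gg> \<Longrightarrow> q \<in> free_alg \<gg> \<Longrightarrow> p - q \<in> free_alg \<gg>"
  using free_alg_add[OF _ free_alg_uminus] by fastforce

lemma free_alg_scale: "p \<in> free_alg \<gg> \<Longrightarrow> pm_scale c p \<in> free_alg \<gg>"
  by (auto simp: free_alg_def in_keys_iff)

lemma free_alg_mult: "p \<in> free_alg \<gg> \<Longrightarrow> q \<in> free_alg \<gg> \<Longrightarrow> p * q \<in> free_alg \<gg>"
  using Poly_Mapping.keys_mult[of p q] by (fastforce simp: free_alg_def plus_word_def)

lemma (in lie_algebra) uea_ideal_subset: "uea_ideal smul \<gg> bracket \<subseteq> free_alg \<gg>"
proof
  fix p assume "p \<in> uea_ideal smul \<gg> bracket"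
  then show "p \<in> free_alg \<gg>"
    by (induction rule: uea_ideal.induct)
      (auto simp: free_alg_def[of \<gg>, THEN eqset_imp_iff, of 0]
        intro!: free_alg_add free_alg_mult free_alg_diff free_alg_gen free_alg_scale
          bracket_closed subspace_add[OF subspace_carrier] subspace_scale[OF subspace_carrier])
qed

context lie_module
begin

lemma foldr_act_add:
  "set ws \<subseteq> \<gg> \<Longrightarrow> foldr act ws (v + w) = foldr act ws v + foldr act ws w"
  by (induction ws) (auto simp: act_add_right)

lemma foldr_act_scale:
  "set ws \<subseteq> \<gg> \<Longrightarrow> foldr act ws (scaleM c v) = scaleM c (foldr act ws v)"
  by (induction ws) (auto simp: act_scale_right)

lemma foldr_act_zero: "set ws \<subseteq> \<gg> \<Longrightarrow> foldr act ws 0 = 0"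
  using foldr_act_scale[of ws 0 0] by simp

lemma foldr_act_sum:
  "set ws \<subseteq> \<gg> \<Longrightarrow> foldr act ws (\<Sum>i\<in>I. f i) = (\<Sum>i\<in>I. foldr act ws (f i))"
  by (induction I rule: infinite_finite_induct) (auto simp: foldr_act_add foldr_act_zero)

lemma free_act_superset:
  assumes "finite S" "Poly_Mapping.keys p \<subseteq> S"
  shows "free_act scaleM act p v =
    (\<Sum>w\<in>S. scaleM (Poly_Mapping.lookup p w) (foldr act (letters w) v))"
  unfolding free_act_def using assms
  by (intro sum.mono_neutral_left) (auto simp: in_keys_iff)

lemma free_act_add: "free_act scaleM act (p + q) v = free_act scaleM act p v + free_act scaleM act q v"
proof -
  let ?S = "Poly_Mapping.keys p \<union> Poly_Mapping.keys q"
  have "Poly_Mapping.keys (p + q) \<subseteq> ?S"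
    by (rule Poly_Mapping.keys_add)
  then show ?thesis
    by (subst (1 2 3) free_act_superset[of ?S])
      (auto simp: lookup_add M.scale_left_distrib sum.distrib)
qed

lemma free_act_zero: "free_act scaleM act 0 v = 0"
  by (simp add: free_act_def)

lemma free_act_diff: "free_act scaleM act (p - q) v = free_act scaleM act p v - free_act scaleM act q v"
  using free_act_add[of "p - q" q v] by simp

lemma free_act_scale: "free_act scaleM act (pm_scale c p) v = scaleM c (free_act scaleM act p v)"
proof -
  have "Poly_Mapping.keys (pm_scale c p) \<subseteq> Poly_Mapping.keys p"
    by (auto simp: in_keys_iff)
  then show ?thesis
    by (subst free_act_superset[of "Poly_Mapping.keys p"])
      (auto simp: free_act_def M.scale_sum_right)
qed

lemma free_act_sum: "free_act scaleM act (\<Sum>i\<in>I. f i) v = (\<Sum>i\<in>I. free_act scaleM act (f i) v)"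
  by (induction I rule: infinite_finite_induct) (auto simp: free_act_add free_act_zero)

lemma free_act_single:
  "free_act scaleM act (Poly_Mapping.single w c) v = scaleM c (foldr act (letters w) v)"
  by (cases "c = 0") (auto simp: free_act_def)

lemma free_act_gen: "free_act scaleM act (gen x) v = act x v"
  by (simp add: gen_def free_act_single)

lemma free_act_mult:
  assumes "p \<in> free_alg \<gg>"
  shows "free_act scaleM act (p * q) v = free_act scaleM act p (free_act scaleM act q v)"
proof -
  have "p * q = (\<Sum>u\<in>Poly_Mapping.keys p. \<Sum>w\<in>Poly_Mapping.keys q.
      Poly_Mapping.single (u + w) (Poly_Mapping.lookup p u * Poly_Mapping.lookup q w))"
    by (subst pm_expand[of p], subst pm_expand[of q]) (simp add: sum_product mult_single)
  also have "free_act scaleM act \<dots> v = (\<Sum>u\<in>Poly_Mapping.keys p. \<Sum>w\<in>Poly_Mapping.keys q.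
      scaleM (Poly_Mapping.lookup p u)
        (scaleM (Poly_Mapping.lookup q w) (foldr act (letters u) (foldr act (letters w) v))))"
    by (simp add: free_act_sum free_act_single plus_word_def)
  also have "\<dots> = free_act scaleM act p (free_act scaleM act q v)"
    unfolding free_act_def[of _ _ p] free_act_def[of _ _ q] M.scale_sum_right[symmetric]
    using assms by (auto simp: free_alg_def foldr_act_sum foldr_act_scale intro!: sum.cong)
  finally show ?thesis .
qed

lemma free_act_linear_right:
  assumes "p \<in> free_alg \<gg>"
  shows "free_act scaleM act p 0 = 0"
  using assms by (auto simp: free_act_def free_alg_def foldr_act_zero intro!: sum.neutral)

lemma uea_ideal_acts_zero:
  "p \<in> uea_ideal smul \<gg> bracket \<Longrightarrow> free_act scaleM act p v = 0"
proof (induction arbitrary: v rule: uea_ideal.induct)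
  case (mult p a b)
  have "a * p \<in> free_alg \<gg>"
    using mult uea_ideal_subset by (auto intro: free_alg_mult)
  then show ?case
    using mult by (simp add: free_act_mult free_act_linear_right)
qed (auto simp: free_act_zero free_act_add free_act_diff free_act_gen free_act_scale free_act_mult
    free_alg_gen act_add_left act_scale_left act_bracket)

lemma uea_act_class:
  assumes u: "u \<in> uea smul \<gg> bracket" and p: "p \<in> u"
  shows "uea_act scaleM act u v = free_act scaleM act p v"
proof -
  obtain r where r: "u = {q. r \<in> free_alg \<gg> \<and> q \<in> free_alg \<gg> \<and> r - q \<in> uea_ideal smul \<gg> bracket}"
    using u by (auto simp: uea_def quotient_def)
  have "free_act scaleM act q v = free_act scaleM act r v" if "q \<in> u" for q
    using that uea_ideal_acts_zero[of "r - q" v] by (auto simp: r free_act_diff)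
  then have "(\<lambda>q. free_act scaleM act q v) ` u = {free_act scaleM act p v}"
    using p by (auto simp: image_iff)
  then show ?thesis
    by (simp add: uea_act_def)
qed

end


section \<open>Differential operators on Laurent polynomials\<close>

type_synonym 'n laurent = "(int, 'n) vec \<Rightarrow>\<^sub>0 complex"
type_synonym 'n laurent_op = "'n laurent \<Rightarrow> 'n laurent"

definition laurent_monom :: "int ^ 'n::finite \<Rightarrow> 'n laurent" where
  "laurent_monom m = Poly_Mapping.single m 1"

text \<open>The operator \<open>\<partial>/\<partial>t\<^sub>i\<close>, and below it \<open>D\<^sub>i = t\<^sub>i \<partial>/\<partial>t\<^sub>i\<close>.\<close>

definition partial :: "'n::finite \<Rightarrow> 'n laurent_op" where
  "partial i f = (\<Sum>k\<in>Poly_Mapping.keys f.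
    Poly_Mapping.single (k - axis i 1) (of_int (k $ i) * Poly_Mapping.lookup f k))"

definition euler :: "'n::finite \<Rightarrow> 'n laurent_op" where
  "euler i f = laurent_monom (axis i 1) * partial i f"

text \<open>The fold composes the powers of the \<^const>\<open>euler\<close> operators in an unspecified order; they
  commute, see \<open>euler_pow_commute\<close>.\<close>

definition euler_pow :: "nat ^ 'n::finite \<Rightarrow> 'n laurent_op" where
  "euler_pow n f = Finite_Set.fold (\<lambda>i. euler i ^^ (n $ i)) f UNIV"

definition diff_monom :: "int ^ 'n::finite \<Rightarrow> nat ^ 'n \<Rightarrow> 'n laurent_op" where
  "diff_monom m n f = laurent_monom m * euler_pow n f"

definition op_scale :: "complex \<Rightarrow> 'n::finite laurent_op \<Rightarrow> 'n laurent_op" where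
  "op_scale c P = (\<lambda>f. pm_scale c (P f))"

global_interpretation laurent_op: vector_space op_scale
  by standard (auto simp: op_scale_def fun_eq_iff pm.scale_right_distrib pm.scale_left_distrib)

definition diff_monoms :: "'n::finite laurent_op set" where
  "diff_monoms = {diff_monom m n | m n. True}"

text \<open>The span of the monomials is closed under composition; \<open>diff_monom_comp\<close> is the
  explicit product formula.\<close>

definition diff_ops :: "'n::finite laurent_op set" where
  "diff_ops = laurent_op.span diff_monoms"

definition commutator :: "'n::finite laurent_op \<Rightarrow> 'n laurent_op \<Rightarrow> 'n laurent_op" where
  "commutator P Q = (P \<circ> Q) - (Q \<circ> P)"

definition cartan :: "'n::finite laurent_op set" where
  "cartan = laurent_op.span (range euler)"


section \<open>The modules \<open>\<Omega>(\<Lambda>, \<epsilon>)\<close>\<close>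

type_synonym 'n mpoly = "(nat, 'n) vec \<Rightarrow>\<^sub>0 complex"

definition mconst :: "complex \<Rightarrow> 'n::finite mpoly" where
  "mconst c = Poly_Mapping.single 0 c"

definition mvar :: "'n::finite \<Rightarrow> 'n mpoly" where
  "mvar i = Poly_Mapping.single (axis i 1) 1"

definition msubst :: "('n::finite \<Rightarrow> 'n mpoly) \<Rightarrow> 'n mpoly \<Rightarrow> 'n mpoly" where
  "msubst g f = (\<Sum>k\<in>Poly_Mapping.keys f.
    mconst (Poly_Mapping.lookup f k) * (\<Prod>i\<in>UNIV. g i ^ (k $ i)))"

definition omega_monom ::
    "complex ^ 'n::finite \<Rightarrow> nat \<Rightarrow> int ^ 'n \<Rightarrow> nat ^ 'n \<Rightarrow> 'n mpoly \<Rightarrow> 'n mpoly" where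
  "omega_monom \<Lambda> \<epsilon> m n f =
    pm_scale (((-1) ^ (1 - \<epsilon>)) powi (1 - (\<Sum>i\<in>UNIV. int (n $ i))) * (\<Prod>i\<in>UNIV. (\<Lambda> $ i) powi (m $ i)))
      ((\<Prod>j\<in>UNIV. (mvar j - mconst (of_nat \<epsilon> * of_int (m $ j))) ^ (n $ j)) *
        msubst (\<lambda>i. mvar i - mconst (of_int (m $ i))) f)"

text \<open>The linear extension from the basis of differential monomials, which are pairwise distinct
  and linearly independent by \<open>inj_diff_monom\<close> and \<open>independent_diff_monoms\<close>.\<close>

definition omega :: "complex ^ 'n::finite \<Rightarrow> nat \<Rightarrow> 'n laurent_op \<Rightarrow> 'n mpoly \<Rightarrow> 'n mpoly" where
  "omega \<Lambda> \<epsilon> P f =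
    (\<Sum>(m, n) | laurent_op.representation diff_monoms P (diff_monom m n) \<noteq> 0.
      pm_scale (laurent_op.representation diff_monoms P (diff_monom m n)) (omega_monom \<Lambda> \<epsilon> m n f))"


section \<open>Basic facts on differential operators\<close>

lemma lookup_euler:
  "Poly_Mapping.lookup (euler i f) k = of_int (k $ i) * Poly_Mapping.lookup f k"
proof -
  have "euler i f = (\<Sum>k\<in>Poly_Mapping.keys f.
      Poly_Mapping.single k (of_int (k $ i) * Poly_Mapping.lookup f k))"
    by (simp add: euler_def partial_def laurent_monom_def sum_distrib_left mult_single)
  then show ?thesis
    by (auto simp: lookup_sum lookup_single when_def in_keys_iff)
qed

lemma lookup_euler_funpow:
  "Poly_Mapping.lookup ((euler i ^^ e) f) k = of_int (k $ i) ^ e * Poly_Mapping.lookup f k"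
  by (induction e) (auto simp: lookup_euler)

lemma euler_pow_commute: "comp_fun_commute (\<lambda>i. euler i ^^ (n $ i))"
  by standard (auto intro!: poly_mapping_eqI simp: fun_eq_iff lookup_euler_funpow)

lemma lookup_euler_pow:
  "Poly_Mapping.lookup (euler_pow n f) k =
    (\<Prod>i\<in>UNIV. of_int (k $ i) ^ (n $ i)) * Poly_Mapping.lookup f k"
proof -
  interpret comp_fun_commute "\<lambda>i. euler i ^^ (n $ i)"
    by (rule euler_pow_commute)
  have "Poly_Mapping.lookup (Finite_Set.fold (\<lambda>i. euler i ^^ (n $ i)) f A) k =
      (\<Prod>i\<in>A. of_int (k $ i) ^ (n $ i)) * Poly_Mapping.lookup f k" if "finite A" for A
    using that by (induction A rule: finite_induct) (auto simp: lookup_euler_funpow)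
  then show ?thesis
    by (simp add: euler_pow_def)
qed


lemma lookup_laurent_monom_mult:
  "Poly_Mapping.lookup (laurent_monom m * f) k = Poly_Mapping.lookup f (k - m)"
proof -
  have "laurent_monom m * f =
      (\<Sum>l\<in>Poly_Mapping.keys f. Poly_Mapping.single (m + l) (Poly_Mapping.lookup f l))"
    by (subst pm_expand[of f]) (simp add: laurent_monom_def sum_distrib_left mult_single)
  then have "Poly_Mapping.lookup (laurent_monom m * f) k =
      (\<Sum>l\<in>Poly_Mapping.keys f. if l = k - m then Poly_Mapping.lookup f l else 0)"
    by (auto simp: lookup_sum lookup_single when_def algebra_simps intro!: sum.cong)
  then show ?thesis
    by (auto simp: in_keys_iff)
qed

lemma lookup_diff_monom:
  "Poly_Mapping.lookup (diff_monom m n f) k =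
    (\<Prod>i\<in>UNIV. of_int (k $ i - m $ i) ^ (n $ i)) * Poly_Mapping.lookup f (k - m)"
  by (simp add: diff_monom_def lookup_laurent_monom_mult lookup_euler_pow)

lemma sum_fun_apply: "(\<Sum>i\<in>I. F i) x = (\<Sum>i\<in>I. F i x)" for F :: "_ \<Rightarrow> _ \<Rightarrow> 'b::ab_group_add"
  by (induction I rule: infinite_finite_induct) auto

lemma diff_monom_comp:
  "diff_monom r m \<circ> diff_monom s n =
    (\<Sum>i | \<forall>j. i $ j \<le> m $ j.
      op_scale (\<Prod>j\<in>UNIV. of_nat (m $ j choose i $ j) * of_int (s $ j) ^ (i $ j))
        (diff_monom (r + s) (m + n - i)))"
  (is "?L = ?R")
proof (rule ext, rule poly_mapping_eqI)
  fix f :: "'a laurent" and k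
  define a :: "'a \<Rightarrow> complex" where "a j = of_int (k $ j - (r $ j + s $ j))" for j
  define b :: "'a \<Rightarrow> complex" where "b j = of_int (s $ j)" for j
  define c where "c = Poly_Mapping.lookup f (k - (r + s))"
  have fin: "finite {i :: nat^'a. \<forall>j. i $ j \<le> m $ j}"
  proof (rule finite_subset)
    show "{i :: nat^'a. \<forall>j. i $ j \<le> m $ j} \<subseteq> vec_lambda ` (PiE UNIV (\<lambda>j. {..m $ j}))"
    proof
      fix i :: "nat^'a" assume "i \<in> {i. \<forall>j. i $ j \<le> m $ j}"
      then have "vec_nth i \<in> PiE UNIV (\<lambda>j. {..m $ j})" by auto
      then show "i \<in> vec_lambda ` (PiE UNIV (\<lambda>j. {..m $ j}))"
        by (metis image_eqI vec_nth_inverse)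
    qed
  qed (auto intro!: finite_imageI finite_PiE)
  have "Poly_Mapping.lookup (?L f) k = (\<Prod>j\<in>UNIV. (a j + b j) ^ (m $ j) * a j ^ (n $ j)) * c"
    by (simp add: lookup_diff_monom a_def b_def c_def prod.distrib diff_diff_eq)
  also have "(\<Prod>j\<in>UNIV. (a j + b j) ^ (m $ j) * a j ^ (n $ j)) =
      (\<Prod>j\<in>UNIV. \<Sum>i\<le>m $ j. of_nat (m $ j choose i) * b j ^ i * a j ^ (m $ j + n $ j - i))"
  proof (rule prod.cong[OF refl])
    fix j
    show "(a j + b j) ^ (m $ j) * a j ^ (n $ j) =
        (\<Sum>i\<le>m $ j. of_nat (m $ j choose i) * b j ^ i * a j ^ (m $ j + n $ j - i))"
      by (subst add.commute, subst binomial_ring)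
        (auto simp: sum_distrib_right mult.assoc power_add[symmetric] intro!: sum.cong)
  qed
  also have "\<dots> = (\<Sum>i\<in>PiE UNIV (\<lambda>j. {..m $ j}).
      \<Prod>j\<in>UNIV. of_nat (m $ j choose i j) * b j ^ i j * a j ^ (m $ j + n $ j - i j))"
    by (rule prod_sum_PiE) auto
  also have "\<dots> = (\<Sum>i | \<forall>j. i $ j \<le> m $ j.
      \<Prod>j\<in>UNIV. of_nat (m $ j choose i $ j) * b j ^ (i $ j) * a j ^ (m $ j + n $ j - i $ j))"
    by (rule sum.reindex_bij_witness[of _ vec_nth vec_lambda]) auto
  also have "\<dots> * c = Poly_Mapping.lookup (?R f) k"
    by (simp add: sum_fun_apply op_scale_def lookup_sum lookup_diff_monom sum_distrib_right
        sum_distrib_left prod.distrib a_def b_def c_def algebra_simps)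
  finally show "Poly_Mapping.lookup (?L f) k = Poly_Mapping.lookup (?R f) k" .
qed

lemma mpoly_zero_on_ints:
  fixes c :: "'k \<Rightarrow> complex" and e :: "'k \<Rightarrow> 'n \<Rightarrow> nat"
  assumes "finite A" "finite N"
    and "\<And>p q. p \<in> N \<Longrightarrow> q \<in> N \<Longrightarrow> (\<And>i. i \<in> A \<Longrightarrow> e p i = e q i) \<Longrightarrow> p = q"
    and "\<And>k :: 'n \<Rightarrow> int. (\<Sum>p\<in>N. c p * (\<Prod>i\<in>A. of_int (k i) ^ e p i)) = 0"
    and "p \<in> N"
  shows "c p = 0"
  using assms
proof (induction A arbitrary: N rule: finite_induct)
  case empty
  then have "N = {p}" by auto
  with empty show ?case by simp
next
  case (insert a A)
  define N' where "N' d = {q \<in> N. e q a = d}" for d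
  have fin: "finite (N' d)" for d using insert.prems by (simp add: N'_def)
  have eq: "(\<Sum>q\<in>N' d. c q * (\<Prod>i\<in>A. of_int (k i) ^ e q i)) = 0" for d and k :: "'n \<Rightarrow> int"
  proof -
    define g where "g q = c q * (\<Prod>i\<in>A. of_int (k i) ^ e q i)" for q
    define P where "P = (\<Sum>q\<in>N. monom (g q) (e q a))"
    have "poly P (of_int z) = 0" for z
    proof -
      have "(\<Sum>q\<in>N. c q * (\<Prod>i\<in>insert a A. of_int ((k(a := z)) i) ^ e q i)) = 0"
        by (rule insert.prems)
      moreover have "(\<Prod>i\<in>A. of_int (if i = a then z else k i) ^ e q i) =
          (\<Prod>i\<in>A. (of_int (k i) :: complex) ^ e q i)" for q
        using insert.hyps by (intro prod.cong) auto
      ultimately show ?thesis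
        using insert.hyps by (simp add: P_def poly_sum poly_monom g_def mult_ac)
    qed
    then have "range (of_int :: int \<Rightarrow> complex) \<subseteq> {x. poly P x = 0}" by auto
    moreover have "infinite (range (of_int :: int \<Rightarrow> complex))"
      by (simp add: finite_image_iff infinite_UNIV_int inj_on_def)
    ultimately have "P = 0"
      using finite_subset poly_roots_finite by blast
    then have "0 = coeff P d" by simp
    also have "\<dots> = (\<Sum>q\<in>N. if e q a = d then g q else 0)"
      by (simp add: P_def coeff_sum)
    also have "\<dots> = (\<Sum>q\<in>N' d. g q)"
      using insert.prems by (simp add: N'_def sum.inter_filter)
    finally show ?thesis by (simp add: g_def)
  qed
  have inj: "q = r" if "q \<in> N' (e p a)" "r \<in> N' (e p a)" "\<And>i. i \<in> A \<Longrightarrow> e q i = e r i" for q r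
    by (rule insert.prems(2)) (use that in \<open>auto simp: N'_def\<close>)
  have "p \<in> N' (e p a)"
    using insert.prems(4) by (simp add: N'_def)
  from insert.IH[OF fin inj eq this] show ?case .
qed

lemma diff_monom_sum_eq_zero:
  fixes c :: "(int ^ 'n::finite) \<times> (nat ^ 'n) \<Rightarrow> complex"
  assumes "finite S" and zero: "(\<Sum>(m, n)\<in>S. op_scale (c (m, n)) (diff_monom m n)) = 0"
    and mn: "(m, n) \<in> S"
  shows "c (m, n) = 0"
proof (rule mpoly_zero_on_ints[of UNIV "{n. (m, n) \<in> S}" vec_nth "\<lambda>n. c (m, n)" n])
  have "{n. (m, n) \<in> S} \<subseteq> snd ` S" by force
  then show fin: "finite {n. (m, n) \<in> S}"
    using assms(1) finite_subset by blast
  show "(\<Sum>n | (m, n) \<in> S. c (m, n) * (\<Prod>i\<in>UNIV. of_int (k i) ^ (n $ i))) = 0"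
    for k :: "'n \<Rightarrow> int"
  proof -
    define f where "f = laurent_monom (vec_lambda k)"
    have "0 = Poly_Mapping.lookup ((\<Sum>(m, n)\<in>S. op_scale (c (m, n)) (diff_monom m n)) f)
        (vec_lambda k + m)"
      using zero by simp
    also have "\<dots> = (\<Sum>(m', n)\<in>S. if m' = m then c (m', n) * (\<Prod>i\<in>UNIV. of_int (k i) ^ (n $ i)) else 0)"
      by (auto simp: sum_fun_apply lookup_sum op_scale_def lookup_diff_monom f_def laurent_monom_def
          lookup_single when_def case_prod_beta intro!: sum.cong)
    also have "\<dots> = (\<Sum>(m', n)\<in>Pair m ` {n. (m, n) \<in> S}. c (m', n) * (\<Prod>i\<in>UNIV. of_int (k i) ^ (n $ i)))"
      using assms(1) by (intro sum.mono_neutral_cong_right) auto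
    also have "\<dots> = (\<Sum>n | (m, n) \<in> S. c (m, n) * (\<Prod>i\<in>UNIV. of_int (k i) ^ (n $ i)))"
      by (subst sum.reindex) (auto simp: inj_on_def)
    finally show ?thesis by simp
  qed
next
  show "p = q" if "\<And>i. i \<in> UNIV \<Longrightarrow> p $ i = q $ i" for p q :: "nat ^ 'n"
    using that by (simp add: vec_eq_iff)
qed (use mn in simp_all)

lemma diff_monom_eqD:
  assumes eq: "diff_monom m n = diff_monom m' n'"
  shows "(m, n) = (m', n')"
proof (rule ccontr)
  assume ne: "(m, n) \<noteq> (m', n')"
  define c :: "_ \<Rightarrow> complex" where "c p = (if p = (m, n) then 1 else -1)" for p
  have "c (m, n) = 0"
  proof (rule diff_monom_sum_eq_zero[where c = c and S = "{(m, n), (m', n')}"])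
    have "(\<Sum>(m, n)\<in>{(m, n), (m', n')}. op_scale (c (m, n)) (diff_monom m n)) =
        op_scale (c (m, n)) (diff_monom m n) + op_scale (c (m', n')) (diff_monom m' n')"
      using ne by (subst sum.insert) simp_all
    also have "\<dots> = op_scale 1 (diff_monom m n) - op_scale 1 (diff_monom m n)"
      using ne by (simp only: c_def eq[symmetric] if_True if_False refl ne[symmetric]
          laurent_op.scale_minus_left add_uminus_conv_diff)
    finally show "(\<Sum>(m, n)\<in>{(m, n), (m', n')}. op_scale (c (m, n)) (diff_monom m n)) = 0"
      by (simp only: diff_self)
  qed simp_all
  then show False by (simp add: c_def)
qed

lemma inj_diff_monom: "diff_monom m n = diff_monom m' n' \<longleftrightarrow> m = m' \<and> n = n'"
  using diff_monom_eqD by (metis prod.inject)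

lemma independent_diff_monoms: "laurent_op.independent (diff_monoms :: 'n::finite laurent_op set)"
proof
  assume "laurent_op.dependent (diff_monoms :: 'n laurent_op set)"
  then obtain S :: "'n laurent_op set" and u P where S: "S \<subseteq> diff_monoms" "finite S"
    and zero: "(\<Sum>P\<in>S. op_scale (u P) P) = 0" and P: "P \<in> S" and ne: "u P \<noteq> 0"
    unfolding laurent_op.dependent_explicit by auto
  define h where "h = (\<lambda>(m, n). diff_monom m n :: 'n laurent_op)"
  have inj: "inj h" by (auto simp: inj_on_def h_def inj_diff_monom)
  have "S \<subseteq> range h" using S(1) by (auto simp: diff_monoms_def h_def)
  then obtain T where T: "S = h ` T" by (meson subset_imageE)
  have inj_T: "inj_on h T" using inj by (rule inj_on_subset) simp
  have "(\<Sum>(m, n)\<in>T. op_scale (u (h (m, n))) (diff_monom m n)) = (\<Sum>P\<in>S. op_scale (u P) P)"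
    unfolding T sum.reindex[OF inj_T] by (simp add: h_def case_prod_beta)
  then have sum0: "(\<Sum>(m, n)\<in>T. op_scale (u (h (m, n))) (diff_monom m n)) = 0"
    using zero by simp
  have fin: "finite T" using S(2) inj_T by (simp add: T finite_image_iff)
  obtain m n where mn: "(m, n) \<in> T" "P = h (m, n)" using P T by auto
  have "u (h (m, n)) = 0"
  proof (rule diff_monom_sum_eq_zero[where c = "\<lambda>p. u (h p)" and S = T and m = m and n = n])
    show "(\<Sum>(m, n)\<in>T. op_scale (u (h (m, n))) (diff_monom m n)) = 0" by (rule sum0)
  qed (rule fin mn(1))+
  with ne show False
    by (simp only: mn(2) simp_thms)
qed

lemma diff_monom_in: "diff_monom m n \<in> diff_ops"
  by (auto simp: diff_ops_def diff_monoms_def intro: laurent_op.span_base)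

lemma subspace_diff_ops: "laurent_op.subspace diff_ops"
  by (simp add: diff_ops_def laurent_op.subspace_span)

lemma diff_ops_induct [consumes 1, case_names zero step]:
  assumes "P \<in> diff_ops" and "Q 0"
    and "\<And>c m n R. R \<in> diff_ops \<Longrightarrow> Q R \<Longrightarrow> Q (op_scale c (diff_monom m n) + R)"
  shows "Q P"
proof -
  have "P \<in> diff_ops \<and> Q P"
    using assms(1) unfolding diff_ops_def
  proof (induction rule: laurent_op.span_induct_alt)
    case base
    show ?case using assms(2) laurent_op.span_zero by blast
  next
    case (step c x y)
    then obtain m n where x: "x = diff_monom m n"
      by (auto simp: diff_monoms_def)
    have "op_scale c x + y \<in> laurent_op.span diff_monoms"
      using step by (blast intro: laurent_op.span_add laurent_op.span_scale laurent_op.span_base)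
    moreover have "Q (op_scale c x + y)"
      unfolding x using step by (intro assms(3)) (auto simp: diff_ops_def)
    ultimately show ?case ..
  qed
  then show ?thesis ..
qed

lemma diff_monom_linear:
  "diff_monom m n (f + g) = diff_monom m n f + diff_monom m n g"
  "diff_monom m n (pm_scale c f) = pm_scale c (diff_monom m n f)"
  by (auto intro!: poly_mapping_eqI simp: lookup_add lookup_diff_monom algebra_simps)

lemma diff_ops_linear:
  assumes "P \<in> diff_ops"
  shows "P (f + g) = P f + P g" "P (pm_scale c f) = pm_scale c (P f)"
  using assms
  by (induction rule: diff_ops_induct)
    (auto simp: op_scale_def diff_monom_linear pm.scale_right_distrib mult.commute)

lemma diff_ops_comp:
  assumes P: "P \<in> diff_ops" and Q: "Q \<in> diff_ops"
  shows "P \<circ> Q \<in> (diff_ops :: 'a::finite laurent_op set)"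
proof -
  note closed = laurent_op.subspace_0[OF subspace_diff_ops]
    laurent_op.subspace_add[OF subspace_diff_ops] laurent_op.subspace_scale[OF subspace_diff_ops]
    laurent_op.subspace_sum[OF subspace_diff_ops] diff_monom_in
  have left: "diff_monom m n \<circ> Q \<in> diff_ops" for m n
    using Q
  proof (induction rule: diff_ops_induct)
    case zero
    have "diff_monom m n \<circ> (0 :: 'a laurent_op) = 0"
      by (auto intro!: poly_mapping_eqI simp: fun_eq_iff lookup_diff_monom)
    then show ?case using closed(1) by (simp only:)
  next
    case (step c m' n' R)
    have "diff_monom m n \<circ> (op_scale c (diff_monom m' n') + R) =
        op_scale c (diff_monom m n \<circ> diff_monom m' n') + (diff_monom m n \<circ> R)"
      by (auto simp: fun_eq_iff op_scale_def diff_monom_linear)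
    moreover have "op_scale c (diff_monom m n \<circ> diff_monom m' n') \<in> diff_ops"
      unfolding diff_monom_comp by (intro closed)
    ultimately show ?case
      using closed(2) step by metis
  qed
  show ?thesis
    using P
  proof (induction rule: diff_ops_induct)
    case zero
    have "(0 :: 'a laurent_op) \<circ> Q = 0" by (simp add: fun_eq_iff)
    then show ?case using closed(1) by (simp only:)
  next
    case (step c m n R)
    have "(op_scale c (diff_monom m n) + R) \<circ> Q = op_scale c (diff_monom m n \<circ> Q) + (R \<circ> Q)"
      by (auto simp: fun_eq_iff op_scale_def)
    then show ?case
      using closed(2) closed(3)[OF left] step by metis
  qed
qed

lemma diff_ops_diff:
  assumes "P \<in> diff_ops"
  shows "P (f - g) = P f - P g"
  using diff_ops_linear(1)[OF assms, of "f - g" g] by (simp add: algebra_simps)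

lemma diff_ops_0: "P \<in> diff_ops \<Longrightarrow> P 0 = 0"
  using diff_ops_diff[of P 0 0] by simp

lemma lie_algebra_diff_ops: "lie_algebra op_scale diff_ops commutator"
proof unfold_locales
  fix x y z :: "'n::finite laurent_op" and c
  assume xyz: "x \<in> diff_ops" "y \<in> diff_ops"
  show "commutator x y \<in> diff_ops"
    unfolding commutator_def using xyz
    by (intro laurent_op.subspace_diff[OF subspace_diff_ops] diff_ops_comp)
  show "commutator (op_scale c x) y = op_scale c (commutator x y)"
    and "commutator x (op_scale c y) = op_scale c (commutator x y)"
    using xyz by (auto simp: commutator_def op_scale_def fun_eq_iff diff_ops_linear diff_ops_0 pm.scale_right_diff_distrib)
  show "commutator x x = 0"
    unfolding commutator_def by (rule diff_self)
  assume z: "z \<in> diff_ops"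
  show "commutator (x + y) z = commutator x z + commutator y z"
    and "commutator x (y + z) = commutator x y + commutator x z"
    using xyz z by (auto simp: commutator_def fun_eq_iff diff_ops_linear)
  show "commutator x (commutator y z) + commutator y (commutator z x) + commutator z (commutator x y) = 0"
  proof
    fix f
    show "(commutator x (commutator y z) + commutator y (commutator z x) +
        commutator z (commutator x y)) f = 0 f"
      unfolding commutator_def plus_fun_apply minus_apply comp_apply zero_fun_apply
        diff_ops_diff[OF xyz(1)] diff_ops_diff[OF xyz(2)] diff_ops_diff[OF z]
      by (simp add: algebra_simps)
  qed
qed (rule subspace_diff_ops)

lemma euler_eq: "euler i = diff_monom 0 (axis i 1)"
proof (rule ext, rule poly_mapping_eqI)
  fix f :: "'a laurent" and k
  have "(\<Prod>j\<in>UNIV. of_int (k $ j) ^ (axis i (1::nat) $ j)) =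
      (\<Prod>j\<in>UNIV. if j = i then of_int (k $ j) else (1::complex))"
    by (intro prod.cong) (auto simp: axis_def)
  then show "Poly_Mapping.lookup (euler i f) k = Poly_Mapping.lookup (diff_monom 0 (axis i 1) f) k"
    by (simp add: lookup_euler lookup_diff_monom)
qed

lemma cartan_subset: "cartan \<subseteq> diff_ops"
  unfolding cartan_def by (rule laurent_op.span_minimal[OF _ subspace_diff_ops]) (auto simp: euler_eq diff_monom_in)

lemma cartan_abelian:
  assumes "P \<in> cartan" "Q \<in> cartan"
  shows "commutator P Q = 0"
proof -
  have mult: "\<exists>a. \<forall>f k. Poly_Mapping.lookup (P f) k = a k * Poly_Mapping.lookup f k"
    if "P \<in> cartan" for P :: "'a laurent_op"
    using that unfolding cartan_def
  proof (induction rule: laurent_op.span_induct_alt)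
    case base
    show ?case by (rule exI[of _ "\<lambda>_. 0"]) simp
  next
    case (step c P R)
    then obtain a i where "\<forall>f k. Poly_Mapping.lookup (R f) k = a k * Poly_Mapping.lookup f k"
      and "P = euler i" by auto
    then show ?case
      by (intro exI[of _ "\<lambda>k. c * of_int (k $ i) + a k"])
        (auto simp: op_scale_def lookup_add lookup_euler algebra_simps)
  qed
  obtain a b where "\<And>f k. Poly_Mapping.lookup (P f) k = a k * Poly_Mapping.lookup f k"
    and "\<And>f k. Poly_Mapping.lookup (Q f) k = b k * Poly_Mapping.lookup f k"
    using mult[OF assms(1)] mult[OF assms(2)] by blast
  then show ?thesis
    by (auto intro!: poly_mapping_eqI simp: commutator_def fun_eq_iff lookup_minus)
qed

lemma lie_algebra_cartan: "lie_algebra op_scale cartan commutator"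
proof -
  interpret lie_algebra op_scale "diff_ops :: 'a laurent_op set" commutator
    by (rule lie_algebra_diff_ops)
  have sub: "laurent_op.subspace (cartan :: 'a laurent_op set)"
    by (simp add: cartan_def laurent_op.subspace_span)
  show ?thesis
    by unfold_locales
      (auto simp: sub cartan_abelian laurent_op.subspace_0[OF sub] laurent_op.subspace_add[OF sub]
        laurent_op.subspace_scale[OF sub])
qed

lemma omega_diff_monom: "omega \<Lambda> \<epsilon> (diff_monom m n) f = omega_monom \<Lambda> \<epsilon> m n f"
proof -
  have rep: "laurent_op.representation diff_monoms (diff_monom m n) =
      (\<lambda>P. if P = diff_monom m n then 1 else 0)"
    by (rule laurent_op.representation_basis[OF independent_diff_monoms]) (auto simp: diff_monoms_def)
  have "{(m', n'). laurent_op.representation diff_monoms (diff_monom m n) (diff_monom m' n') \<noteq> 0} = {(m, n)}"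
    by (auto simp: rep inj_diff_monom)
  then show ?thesis
    by (simp add: omega_def rep)
qed

end

theory Submission
  imports Defs
begin

text \<open>Freeness identifies \<open>M\<close> with the polynomial ring in \<open>x\<^sub>1, \<dots>, x\<^sub>\<nu>\<close>, where \<open>D\<^sub>i\<close> acts as
  multiplication by \<open>x\<^sub>i\<close> (\<open>bij_of_mpoly\<close>). Since \<open>[D\<^sub>i, t\<^sup>m p(D)] = m\<^sub>i t\<^sup>m p(D)\<close>, the operator
  \<open>t\<^sup>m p(D)\<close> sends \<open>f(x)\<close> to \<open>(G m p)(x - m) f(x - m)\<close> for some polynomial \<open>G m p\<close>
  (\<open>fn_act_weyl_op\<close>). In these terms the module structure is a Lie algebra endomorphism
  \<open>t\<^sup>m p(D) \<mapsto> t\<^sup>m (G m p)(D)\<close> that preserves degrees and fixes each \<open>D\<^sub>i\<close>, and the theorem says that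
  \<open>G m p\<close> is \<open>\<Lambda>\<^sup>m p(x)\<close>, which is \<open>\<epsilon> = 1\<close>, or \<open>-\<Lambda>\<^sup>m p(-x - m)\<close>, which is \<open>\<epsilon> = 0\<close>
  (\<open>classification\<close>).

  Write \<open>\<Delta>\<^sub>k p = p(x + k) - p(x)\<close>. From \<open>[p(D), t\<^sup>k q(D)] = t\<^sup>k (\<Delta>\<^sub>k p)(D) q(D)\<close> one gets
  \<open>G k ((\<Delta>\<^sub>k p) q) = \<Delta>\<^sub>k (G 0 p) \<cdot> G k q\<close>. For \<open>k \<noteq> 0\<close> the coordinates are obtained from differences
  of quadratic polynomials, so \<open>G k\<close> turns multiplication by \<open>x\<^sub>i\<close> into multiplication by some
  polynomial, and \<open>G k q = G k 1 \<cdot> (q \<circ> \<alpha>\<^sub>k)\<close> for a polynomial map \<open>\<alpha>\<^sub>k\<close> (\<open>eval_points_ex\<close>). The bracket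
  \<open>[t\<^sup>k D\<^sub>i, t\<^bsup>-k\<^esup> D\<^sub>i] = -2 k\<^sub>i D\<^sub>i\<close> shows \<open>G k 1 \<noteq> 0\<close>; cancelling it leaves
  \<open>\<Delta>\<^sub>k (G 0 p)(x) = p(\<alpha>\<^sub>k(x) + k) - p(\<alpha>\<^sub>k(x))\<close> (\<open>difference_at_point\<close>).

  Telescoping this along \<open>k + l\<close> gives an identity between sums of point evaluations that holds for
  every \<open>p\<close>, hence an equality of multisets of three points. It admits just two solutions, and by
  irreducibility of affine space one of them holds for all \<open>x\<close> (\<open>points_dichotomy\<close>). In one case all
  \<open>\<alpha>\<^sub>k\<close> are the same translation (\<open>points_translation\<close>), and a few brackets then determine \<open>G\<close>
  (\<open>translation_classification\<close>). The other case, where \<open>\<alpha>\<^sub>k\<close> reverses direction, becomes the first one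
  after composition with \<open>t\<^sup>m p(D) \<mapsto> -t\<^sup>m p(-D - m)\<close>.\<close>

section \<open>Polynomial functions\<close>

definition cvec :: "int ^ 'n \<Rightarrow> complex ^ 'n::finite" where
  "cvec k = (\<chi> i. of_int (k $ i))"

lemma cvec_nth [simp]: "cvec k $ i = of_int (k $ i)"
  by (simp add: cvec_def)

lemma cvec_0 [simp]: "cvec 0 = 0"
  by (simp add: vec_eq_iff)

lemma cvec_add: "cvec (k + l) = cvec k + cvec l"
  by (simp add: vec_eq_iff)

lemma cvec_minus: "cvec (- k) = - cvec k"
  by (simp add: vec_eq_iff)

lemma cvec_eq_0_iff [simp]: "cvec k = 0 \<longleftrightarrow> k = 0"
  by (simp add: vec_eq_iff)

text \<open>The rules multiply by one coordinate at a time rather than by an arbitrary polynomial function, so that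
  rule induction runs along monomials.\<close>
inductive_set polyfun :: "(complex ^ 'n::finite \<Rightarrow> complex) set" where
  const: "(\<lambda>x. c) \<in> polyfun"
| add: "f \<in> polyfun \<Longrightarrow> g \<in> polyfun \<Longrightarrow> (\<lambda>x. f x + g x) \<in> polyfun"
| coord_mult: "f \<in> polyfun \<Longrightarrow> (\<lambda>x. x $ i * f x) \<in> polyfun"

lemma polyfun_scale: "f \<in> polyfun \<Longrightarrow> (\<lambda>x. c * f x) \<in> polyfun"
proof (induction rule: polyfun.induct)
  case (coord_mult f i)
  from polyfun.coord_mult[OF this(2), of i] show ?case by (simp add: mult_ac)
qed (auto simp: distrib_left intro: polyfun.intros)

lemma polyfun_mult: "f \<in> polyfun \<Longrightarrow> g \<in> polyfun \<Longrightarrow> (\<lambda>x. f x * g x) \<in> polyfun"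
  by (induction rule: polyfun.induct)
    (auto simp: distrib_right mult.assoc polyfun_scale intro: polyfun.intros)

lemma polyfun_coord: "(\<lambda>x. x $ i) \<in> polyfun"
  using polyfun.coord_mult[OF polyfun.const[of 1], of i] by simp

lemma polyfun_uminus: "f \<in> polyfun \<Longrightarrow> (\<lambda>x. - f x) \<in> polyfun"
  using polyfun_scale[of f "-1"] by simp

lemma polyfun_diff: "f \<in> polyfun \<Longrightarrow> g \<in> polyfun \<Longrightarrow> (\<lambda>x. f x - g x) \<in> polyfun"
  using polyfun.add[OF _ polyfun_uminus[of g], of f] by simp

lemma polyfun_power: "f \<in> polyfun \<Longrightarrow> (\<lambda>x. f x ^ n) \<in> polyfun"
  by (induction n) (auto intro: polyfun.intros polyfun_mult)

lemma polyfun_sum: "(\<And>i. i \<in> I \<Longrightarrow> f i \<in> polyfun) \<Longrightarrow> (\<lambda>x. \<Sum>i\<in>I. f i x) \<in> polyfun"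
  by (induction I rule: infinite_finite_induct) (auto intro: polyfun.intros)

lemma polyfun_prod: "(\<And>i. i \<in> I \<Longrightarrow> f i \<in> polyfun) \<Longrightarrow> (\<lambda>x. \<Prod>i\<in>I. f i x) \<in> polyfun"
  by (induction I rule: infinite_finite_induct) (auto intro: polyfun.intros polyfun_mult)

lemma polyfun_subst:
  "p \<in> polyfun \<Longrightarrow> (\<And>i. (\<lambda>x. a x $ i) \<in> polyfun) \<Longrightarrow> (\<lambda>x. p (a x)) \<in> polyfun"
  by (induction rule: polyfun.induct) (auto intro: polyfun.intros polyfun_mult)

lemma polyfun_shift: "p \<in> polyfun \<Longrightarrow> (\<lambda>x. p (x + c)) \<in> polyfun"
  by (rule polyfun_subst) (auto intro: polyfun.intros polyfun_coord)

lemma polyfun_shift_diff: "p \<in> polyfun \<Longrightarrow> (\<lambda>x. p (x - c)) \<in> polyfun"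
  using polyfun_shift[of p "- c"] by simp

lemma polyfun_reflect: "p \<in> polyfun \<Longrightarrow> (\<lambda>x. p (- x - c)) \<in> polyfun"
  by (rule polyfun_subst) (auto intro!: polyfun_diff polyfun_uminus polyfun.const polyfun_coord)

lemmas polyfun_intros = polyfun.intros polyfun_scale polyfun_mult polyfun_coord polyfun_uminus
  polyfun_diff polyfun_power

text \<open>Restriction to a line reduces questions about zeros and units to polynomials in one variable.\<close>
lemma polyfun_on_line:
  assumes "f \<in> polyfun"
  obtains r where "\<And>t. f (x + t *s y) = poly r t"
proof -
  have "\<exists>r. \<forall>t. f (x + t *s y) = poly r t"
    using assms
  proof (induction rule: polyfun.induct)
    case (const c)
    show ?case by (rule exI[of _ "[:c:]"]) simp
  next
    case (add f g)
    then obtain r s where "\<forall>t. f (x + t *s y) = poly r t" "\<forall>t. g (x + t *s y) = poly s t"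
      by blast
    then show ?case by (intro exI[of _ "r + s"]) simp
  next
    case (coord_mult f i)
    then obtain r where "\<forall>t. f (x + t *s y) = poly r t"
      by blast
    then show ?case by (intro exI[of _ "[:x $ i, y $ i:] * r"]) (simp add: algebra_simps)
  qed
  with that show ?thesis by blast
qed

text \<open>If neither factor vanished identically, the line joining a point where one is nonzero to such a
  point of the other would carry two nonzero
  polynomials in one variable whose product is zero.\<close>
lemma polyfun_mult_eq_0:
  assumes f: "f \<in> polyfun" and g: "g \<in> polyfun" and zero: "\<And>x. f x * g x = 0"
  shows "(\<forall>x. f x = 0) \<or> (\<forall>x. g x = 0)"
proof (rule ccontr)
  assume "\<not> ?thesis"
  then obtain x y where xy: "f x \<noteq> 0" "g y \<noteq> 0" by blast
  obtain r s where r: "\<And>t. f (x + t *s (y - x)) = poly r t"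
    and s: "\<And>t. g (x + t *s (y - x)) = poly s t"
    using polyfun_on_line[OF f] polyfun_on_line[OF g] by metis
  have "poly (r * s) t = 0" for t
    using zero[of "x + t *s (y - x)"] by (simp only: r s poly_mult)
  then have "r * s = 0"
    using poly_all_0_iff_0 by blast
  moreover have "poly r 0 \<noteq> 0" "poly s 1 \<noteq> 0"
    using r[of 0] s[of 1] xy by (auto simp: vec_eq_iff)
  ultimately show False by auto
qed

text \<open>On the line through two points both factors are units of a polynomial ring in one variable, hence
  constant.\<close>
lemma polyfun_unit_const:
  assumes f: "f \<in> polyfun" and g: "g \<in> polyfun" and one: "\<And>x. f x * g x = 1"
  shows "f x = f y"
proof -
  obtain r s where r: "\<And>t. f (x + t *s (y - x)) = poly r t"
    and s: "\<And>t. g (x + t *s (y - x)) = poly s t"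
    using polyfun_on_line[OF f] polyfun_on_line[OF g] by metis
  have "poly (r * s - 1) t = 0" for t
    using one[of "x + t *s (y - x)"] by (simp only: r s poly_mult poly_diff poly_1 diff_self)
  then have "r * s - 1 = 0"
    using poly_all_0_iff_0 by blast
  then have "r dvd 1"
    by (metis dvd_triv_left eq_iff_diff_eq_0)
  then obtain c where "r = [:c:]"
    using is_unit_polyE by blast
  moreover have "f x = poly r 0" "f y = poly r 1"
    using r[of 0] r[of 1] by (simp_all add: vec_eq_iff flip: r)
  ultimately show ?thesis by simp
qed

text \<open>A product of affine coordinate functions, one for each point of \<open>T\<close>.\<close>
lemma polyfun_separates:
  assumes "finite T" "u \<notin> T"
  obtains p where "p \<in> polyfun" "p u = 1" "\<And>t. t \<in> T \<Longrightarrow> p t = 0"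
proof -
  have "\<exists>p\<in>polyfun. p u = 1 \<and> (\<forall>t\<in>T. p t = 0)"
    using assms
  proof (induction T rule: finite_induct)
    case empty
    show ?case by (rule bexI[OF _ polyfun.const[of 1]]) simp
  next
    case (insert a T)
    then obtain p where p: "p \<in> polyfun" "p u = 1" "\<forall>t\<in>T. p t = 0"
      by auto
    from insert obtain i where i: "u $ i \<noteq> a $ i"
      by (auto simp: vec_eq_iff)
    show ?case
      by (rule bexI[of _ "\<lambda>x. inverse (u $ i - a $ i) * (x $ i - a $ i) * p x"])
        (use p i in \<open>auto intro!: polyfun_intros\<close>)
  qed
  with that show ?thesis by blast
qed

section \<open>Polynomials as polynomial functions\<close>

definition eval :: "'n::finite mpoly \<Rightarrow> complex ^ 'n \<Rightarrow> complex" where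
  "eval p x = (\<Sum>n\<in>Poly_Mapping.keys p. Poly_Mapping.lookup p n * (\<Prod>i\<in>UNIV. (x $ i) ^ (n $ i)))"

lemma eval_superset:
  assumes "finite S" "Poly_Mapping.keys p \<subseteq> S"
  shows "eval p x = (\<Sum>n\<in>S. Poly_Mapping.lookup p n * (\<Prod>i\<in>UNIV. (x $ i) ^ (n $ i)))"
  unfolding eval_def using assms
  by (intro sum.mono_neutral_left) (auto simp: in_keys_iff)

lemma eval_single [simp]:
  "eval (Poly_Mapping.single n c) x = c * (\<Prod>i\<in>UNIV. (x $ i) ^ (n $ i))"
  by (cases "c = 0") (auto simp: eval_def)

lemma eval_add [simp]: "eval (p + q) x = eval p x + eval q x"
proof -
  let ?S = "Poly_Mapping.keys p \<union> Poly_Mapping.keys q"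
  have "Poly_Mapping.keys (p + q) \<subseteq> ?S"
    by (rule Poly_Mapping.keys_add)
  then show ?thesis
    by (subst (1 2 3) eval_superset[of ?S])
      (auto simp: lookup_add distrib_right sum.distrib)
qed

lemma eval_zero [simp]: "eval 0 x = 0"
  by (simp add: eval_def)

lemma eval_diff [simp]: "eval (p - q) x = eval p x - eval q x"
  using eval_add[of "p - q" q x] by simp

lemma eval_scale [simp]: "eval (pm_scale c p) x = c * eval p x"
proof -
  have "Poly_Mapping.keys (pm_scale c p) \<subseteq> Poly_Mapping.keys p"
    by (auto simp: in_keys_iff)
  then show ?thesis
    by (subst eval_superset[of "Poly_Mapping.keys p"])
      (auto simp: eval_def sum_distrib_left mult_ac)
qed

lemma eval_sum [simp]: "eval (\<Sum>i\<in>I. f i) x = (\<Sum>i\<in>I. eval (f i) x)"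
  by (induction I rule: infinite_finite_induct) auto

lemma eval_mult [simp]: "eval (p * q) x = eval p x * eval q x"
proof -
  have "p * q = (\<Sum>m\<in>Poly_Mapping.keys p. \<Sum>n\<in>Poly_Mapping.keys q.
      Poly_Mapping.single (m + n) (Poly_Mapping.lookup p m * Poly_Mapping.lookup q n))"
    by (subst pm_expand[of p], subst pm_expand[of q]) (simp add: sum_product mult_single)
  also have "eval \<dots> x = eval p x * eval q x"
    by (simp add: eval_def[of p] eval_def[of q] sum_product power_add prod.distrib mult_ac)
  finally show ?thesis .
qed

lemma eval_mconst [simp]: "eval (mconst c) x = c"
  by (simp add: mconst_def)

lemma prod_power_axis: "(\<Prod>j\<in>UNIV. (x j) ^ (axis i 1 $ j)) = (x i :: 'b::comm_monoid_mult)"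
  for i :: "'n::finite"
proof -
  have "(\<Prod>j\<in>UNIV. (x j) ^ (axis i 1 $ j)) = (\<Prod>j\<in>UNIV. if j = i then x j else 1)"
    by (intro prod.cong) (auto simp: axis_def)
  then show ?thesis by simp
qed

lemma eval_mvar [simp]: "eval (mvar i) x = x $ i"
  using prod_power_axis[of "\<lambda>j. x $ j" i] by (simp add: mvar_def)

lemma eval_one [simp]: "eval 1 x = 1"
  by (simp flip: single_one)

lemma eval_power [simp]: "eval (p ^ n) x = eval p x ^ n"
  by (induction n) auto

lemma eval_prod [simp]: "eval (\<Prod>i\<in>I. f i) x = (\<Prod>i\<in>I. eval (f i) x)"
  by (induction I rule: infinite_finite_induct) auto

lemma eval_msubst: "eval (msubst g f) x = eval f (\<chi> i. eval (g i) x)"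
  by (simp add: msubst_def eval_def[of f])

text \<open>The integer points are Zariski dense; they are the points at which operators on Laurent monomials
  are observed.\<close>
lemma eval_eq_0_on_ints:
  assumes "\<And>k. eval p (cvec k) = 0"
  shows "p = 0"
proof (rule poly_mapping_eqI)
  fix n
  have "Poly_Mapping.lookup p n = 0" if n: "n \<in> Poly_Mapping.keys p"
  proof (rule mpoly_zero_on_ints[of UNIV "Poly_Mapping.keys p" vec_nth "Poly_Mapping.lookup p"])
    show "(\<Sum>n\<in>Poly_Mapping.keys p. Poly_Mapping.lookup p n * (\<Prod>i\<in>UNIV. of_int (k i) ^ (n $ i))) = 0"
      for k :: "'a \<Rightarrow> int"
      using assms[of "vec_lambda k"] by (simp add: eval_def)
  qed (use n in \<open>auto simp: vec_eq_iff\<close>)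
  then show "Poly_Mapping.lookup p n = Poly_Mapping.lookup 0 n"
    by (auto simp: in_keys_iff)
qed

lemma inj_eval: "inj eval"
proof
  fix p q :: "'n::finite mpoly" assume "eval p = eval q"
  then have "p - q = 0" by (intro eval_eq_0_on_ints) simp
  then show "p = q" by simp
qed

lemma range_eval: "range (eval :: 'n::finite mpoly \<Rightarrow> _) = polyfun"
proof (intro equalityI subsetI)
  fix f :: "complex ^ 'n \<Rightarrow> complex" assume "f \<in> range eval"
  then obtain p where "f = eval p" by blast
  then show "f \<in> polyfun"
    unfolding eval_def by (auto intro!: polyfun_sum polyfun_intros polyfun_prod)
next
  fix f :: "complex ^ 'n \<Rightarrow> complex" assume "f \<in> polyfun"
  then show "f \<in> range eval"
  proof (induction rule: polyfun.induct)
    case (const c)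
    have "(\<lambda>x. c) = eval (mconst c)" by (simp add: fun_eq_iff)
    then show ?case by blast
  next
    case (add f g)
    then obtain p q where "f = eval p" "g = eval q" by blast
    then have "(\<lambda>x. f x + g x) = eval (p + q)" by (simp add: fun_eq_iff)
    then show ?case by blast
  next
    case (coord_mult f i)
    then obtain p where "f = eval p" by blast
    then have "(\<lambda>x. x $ i * f x) = eval (mvar i * p)" by (simp add: fun_eq_iff)
    then show ?case by blast
  qed
qed

lemma eval_polyfun: "eval p \<in> polyfun"
  using range_eval by blast

text \<open>Polynomials inherit the rule induction of polynomial functions through the bijection \<open>eval\<close>.\<close>
lemma mpoly_induct [case_names const add mvar_mult]:
  assumes "\<And>c. Q (mconst c)" "\<And>p q. Q p \<Longrightarrow> Q q \<Longrightarrow> Q (p + q)" "\<And>i p. Q p \<Longrightarrow> Q (mvar i * p)"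
  shows "Q p"
proof -
  have "\<exists>q. f = eval q \<and> Q q" if "f \<in> polyfun" for f
    using that
  proof (induction rule: polyfun.induct)
    case (const c)
    have "(\<lambda>x. c) = eval (mconst c)" by (simp add: fun_eq_iff)
    then show ?case using assms(1) by blast
  next
    case (add f g)
    then obtain p q where "f = eval p" "g = eval q" "Q p" "Q q" by blast
    moreover from this have "(\<lambda>x. f x + g x) = eval (p + q)" by (simp add: fun_eq_iff)
    ultimately show ?case using assms(2) by blast
  next
    case (coord_mult f i)
    then obtain p where "f = eval p" "Q p" by blast
    moreover from this have "(\<lambda>x. x $ i * f x) = eval (mvar i * p)" by (simp add: fun_eq_iff)
    ultimately show ?case using assms(3) by blast
  qed
  from this[OF eval_polyfun[of p]] show ?thesis
    using injD[OF inj_eval] by metis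
qed

lemma polyfun_eq_0_on_ints:
  assumes "f \<in> polyfun" "\<And>k. f (cvec k) = 0"
  shows "f x = 0"
proof -
  obtain p where p: "f = eval p"
    using assms(1) range_eval by blast
  with assms(2) have "p = 0"
    by (intro eval_eq_0_on_ints) simp
  with p show ?thesis by simp
qed

lemma polyfun_lattice_invariant:
  assumes f: "f \<in> polyfun" and inv: "\<And>x k. f (x + cvec k) = f x"
  shows "f x = f y"
proof -
  have "f x - f 0 = 0" for x
  proof (rule polyfun_eq_0_on_ints[of "\<lambda>x. f x - f 0"])
    show "(\<lambda>x. f x - f 0) \<in> polyfun" by (intro polyfun_intros f)
    show "f (cvec k) - f 0 = 0" for k using inv[of 0 k] by simp
  qed
  then show ?thesis by (metis right_minus_eq)
qed

section \<open>Relations between point evaluations\<close>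

text \<open>Point evaluations at distinct points are linearly independent. A polynomial that is 1 at \<open>u1\<close> and
  0 at all other points involved makes the left side a positive integer, while the right side vanishes
  unless \<open>u1\<close> occurs there.\<close>
lemma point_sum_mem:
  fixes u1 u2 u3 v1 v2 v3 :: "complex ^ 'n::finite"
  assumes eq: "\<And>p. p \<in> polyfun \<Longrightarrow> p u1 + p u2 + p u3 = p v1 + p v2 + p v3"
  shows "u1 \<in> {v1, v2, v3}"
proof (rule ccontr)
  assume "u1 \<notin> {v1, v2, v3}"
  then obtain p where p: "p \<in> polyfun" "p u1 = 1" "\<And>t. t \<in> {v1, v2, v3} \<union> ({u2, u3} - {u1}) \<Longrightarrow> p t = 0"
    using polyfun_separates[of "{v1, v2, v3} \<union> ({u2, u3} - {u1})" u1] by auto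
  have "p u2 \<in> {0, 1}" "p u3 \<in> {0, 1}"
    using p(2) p(3)[of u2] p(3)[of u3] by auto
  with eq[OF p(1)] p(2) p(3)[of v1] p(3)[of v2] p(3)[of v3] show False
    by auto
qed

text \<open>By independence of point evaluations the multisets \<open>{a + k + l, b, c}\<close> and \<open>{a, b + k, c + l}\<close>
  agree. As \<open>b \<noteq> b + k\<close> and \<open>c \<noteq> c + l\<close>, each of \<open>b\<close> and \<open>c\<close> equals one of the two
  remaining points on the right, and only two of the four combinations survive.\<close>
lemma point_sum_dichotomy:
  fixes a b c k l :: "complex ^ 'n::finite"
  assumes nz: "k \<noteq> 0" "l \<noteq> 0" "k + l \<noteq> 0"
    and eq: "\<And>p. p \<in> polyfun \<Longrightarrow> p (a + k + l) + p b + p c = p a + p (b + k) + p (c + l)"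
  shows "(c = a \<and> b = c + l) \<or> (b = a \<and> c = b + k)"
proof -
  have "c \<in> {a, b + k, c + l}"
  proof (rule point_sum_mem[of c b "a + k + l"])
    show "p c + p b + p (a + k + l) = p a + p (b + k) + p (c + l)" if "p \<in> polyfun" for p
      using eq[OF that] by (simp only: add_ac)
  qed
  then have c: "c = a \<or> c = b + k" using nz by auto
  have "b \<in> {a, b + k, c + l}"
  proof (rule point_sum_mem[of b c "a + k + l"])
    show "p b + p c + p (a + k + l) = p a + p (b + k) + p (c + l)" if "p \<in> polyfun" for p
      using eq[OF that] by (simp only: add_ac)
  qed
  then have b: "b = a \<or> b = c + l" using nz by auto
  have "\<not> (c = a \<and> b = a)"
  proof
    assume "c = a \<and> b = a"
    with eq have eq': "p (a + k + l) + p a + p a = p a + p (a + k) + p (a + l)" if "p \<in> polyfun" for p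
      using that by blast
    have "a \<in> {a + k, a + l, a + k}"
    proof (rule point_sum_mem[of a "a + k + l" "a + k"])
      show "p a + p (a + k + l) + p (a + k) = p (a + k) + p (a + l) + p (a + k)" if "p \<in> polyfun" for p
        using eq'[OF that] by (simp only: add_ac add_left_cancel)
    qed
    then show False using nz by simp
  qed
  moreover have "\<not> (c = b + k \<and> b = c + l)"
    using nz(3) by (auto simp: add.assoc)
  ultimately show ?thesis using b c by blast
qed

text \<open>Irreducibility of affine space: two algebraic sets covering it cannot both be proper.\<close>
lemma polyfun_zero_sets_cover:
  assumes F: "F \<subseteq> polyfun" and H: "H \<subseteq> polyfun"
    and cover: "\<And>x. (\<forall>f\<in>F. f x = 0) \<or> (\<forall>h\<in>H. h x = 0)"
  shows "(\<forall>x. \<forall>f\<in>F. f x = 0) \<or> (\<forall>x. \<forall>h\<in>H. h x = 0)"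
proof (rule ccontr)
  assume "\<not> ?thesis"
  then obtain f h x y where fh: "f \<in> F" "h \<in> H" "f x \<noteq> 0" "h y \<noteq> 0" by blast
  have "f z * h z = 0" for z using cover[of z] fh by auto
  with polyfun_mult_eq_0[of f h] F H fh show False by blast
qed

section \<open>Graded Lie algebra endomorphisms\<close>

text \<open>An operator \<open>t\<^sup>m p(D)\<close> is encoded by its degree \<open>m\<close> and its symbol \<open>p\<close>. Composition is
  \<open>t\<^sup>m p(D) t\<^sup>k q(D) = t\<^bsup>m+k\<^esup> p(D + k) q(D)\<close>, so the bracket axiom says that
  \<open>t\<^sup>m p(D) \<mapsto> t\<^sup>m (G m p)(D)\<close> is a homomorphism of Lie algebras; by \<open>cartan\<close> it fixes every
  \<open>D\<^sub>i\<close>.\<close>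
locale graded_lie_endo =
  fixes G :: "int ^ 'n::finite \<Rightarrow> (complex ^ 'n \<Rightarrow> complex) \<Rightarrow> complex ^ 'n \<Rightarrow> complex"
  assumes poly: "p \<in> polyfun \<Longrightarrow> G m p \<in> polyfun"
    and add: "p \<in> polyfun \<Longrightarrow> q \<in> polyfun \<Longrightarrow> G m (\<lambda>x. p x + q x) x = G m p x + G m q x"
    and scale: "p \<in> polyfun \<Longrightarrow> G m (\<lambda>x. c * p x) x = c * G m p x"
    and cartan: "G 0 (\<lambda>x. x $ i) x = x $ i"
    and bracket: "p \<in> polyfun \<Longrightarrow> q \<in> polyfun \<Longrightarrow>
      G (m + k) (\<lambda>x. p (x + cvec k) * q x - q (x + cvec m) * p x) x =
      G m p (x + cvec k) * G k q x - G k q (x + cvec m) * G m p x"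
begin

lemma uminus: "p \<in> polyfun \<Longrightarrow> G m (\<lambda>x. - p x) x = - G m p x"
  using scale[of p m "-1" x] by simp

lemma diff: "p \<in> polyfun \<Longrightarrow> q \<in> polyfun \<Longrightarrow> G m (\<lambda>x. p x - q x) x = G m p x - G m q x"
  using add[OF _ polyfun_uminus, of p q m x] by (simp add: uminus)

lemma zero: "G m (\<lambda>x. 0) x = 0"
  using scale[of "\<lambda>x. 0" m 0 x] by (simp add: polyfun.const)

text \<open>The image of \<open>[p(D), t\<^sup>k q(D)] = t\<^sup>k (p(D + k) - p(D)) q(D)\<close>: multiplication of symbols of degree
  \<open>k\<close> by a difference passes through \<open>G k\<close>.\<close>
lemma difference_mult:
  assumes "p \<in> polyfun" "q \<in> polyfun"
  shows "G k (\<lambda>x. (p (x + cvec k) - p x) * q x) x = (G 0 p (x + cvec k) - G 0 p x) * G k q x"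
  using bracket[OF assms, of 0 k x] by (simp add: algebra_simps)

text \<open>The multiplications that pass through \<open>G k\<close> contain the differences of all polynomials, by
  \<open>difference_mult\<close>, and differences of quadratic monomials yield every coordinate.\<close>
lemma coord_mult_ex:
  assumes "k \<noteq> 0"
  shows "\<exists>a\<in>polyfun. \<forall>q\<in>polyfun. \<forall>x. G k (\<lambda>x. x $ i * q x) x = a x * G k q x"
proof -
  obtain j where j: "k $ j \<noteq> 0" "k $ i \<noteq> 0 \<Longrightarrow> j = i"
    using assms by (auto simp: vec_eq_iff)
  \<comment> \<open>If \<open>k\<close> moves \<open>x\<^sub>i\<close>, the difference of \<open>x\<^sub>i\<^sup>2\<close> is \<open>2 k\<^sub>i x\<^sub>i + k\<^sub>i\<^sup>2\<close>; otherwise, for an \<open>x\<^sub>j\<close>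
    that \<open>k\<close> moves, the difference of \<open>x\<^sub>i x\<^sub>j\<close> is \<open>k\<^sub>j x\<^sub>i\<close>.\<close>
  define p :: "complex ^ 'n \<Rightarrow> complex" where "p = (\<lambda>x. x $ i * x $ j)"
  define c where "c = (if k $ i = 0 then 1 else 1 / 2 :: complex) / of_int (k $ j)"
  define d where "d = (if k $ i = 0 then 0 else of_int (k $ i) / 2 :: complex)"
  have p: "p \<in> polyfun" unfolding p_def by (intro polyfun_intros)
  have x: "x $ i = c * (p (x + cvec k) - p x) - d" for x
    using j by (cases "k $ i = 0") (auto simp: c_def d_def p_def field_simps)
  show ?thesis
  proof (rule bexI[of _ "\<lambda>x. c * (G 0 p (x + cvec k) - G 0 p x) - d"], intro ballI allI)
    fix q :: "complex ^ 'n \<Rightarrow> complex" and x assume q: "q \<in> polyfun"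
    have pq: "(\<lambda>x. (p (x + cvec k) - p x) * q x) \<in> polyfun"
      by (intro polyfun_mult polyfun_diff polyfun_shift[OF p] p q)
    have "(\<lambda>x. x $ i * q x) = (\<lambda>x. c * ((p (x + cvec k) - p x) * q x) - d * q x)"
      by (subst x) (simp add: algebra_simps)
    then have "G k (\<lambda>x. x $ i * q x) x =
        G k (\<lambda>x. c * ((p (x + cvec k) - p x) * q x) - d * q x) x" by simp
    also have "\<dots> = c * ((G 0 p (x + cvec k) - G 0 p x) * G k q x) - d * G k q x"
      by (subst diff) (auto intro!: polyfun_scale pq q simp: scale pq q difference_mult p)
    finally show "G k (\<lambda>x. x $ i * q x) x = (c * (G 0 p (x + cvec k) - G 0 p x) - d) * G k q x"
      by (simp add: algebra_simps)
  qed (intro polyfun_diff polyfun_scale polyfun_shift[OF poly[OF p]] poly[OF p] polyfun.const)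
qed

end

text \<open>In a nonzero degree \<open>k\<close> the endomorphism substitutes the polynomial map \<open>\<alpha> k\<close> into the symbol and
  multiplies by the image of \<open>t\<^sup>k\<close>. The map \<open>\<alpha> 0\<close> is arbitrary.\<close>
locale graded_lie_endo_points = graded_lie_endo G
  for G :: "int ^ 'n::finite \<Rightarrow> (complex ^ 'n \<Rightarrow> complex) \<Rightarrow> complex ^ 'n \<Rightarrow> complex" +
  fixes \<alpha> :: "int ^ 'n \<Rightarrow> complex ^ 'n \<Rightarrow> complex ^ 'n"
  assumes point_poly: "(\<lambda>x. \<alpha> k x $ i) \<in> polyfun"
    and at_point: "k \<noteq> 0 \<Longrightarrow> q \<in> polyfun \<Longrightarrow> G k q x = G k (\<lambda>_. 1) x * q (\<alpha> k x)"

text \<open>The components of \<open>\<alpha> k\<close> are the multipliers of \<open>coord_mult_ex\<close>; since coordinates generate all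
  polynomials, they determine \<open>G k\<close> up to its value at 1.\<close>
lemma (in graded_lie_endo) eval_points_ex:
  "\<exists>\<alpha>. graded_lie_endo_points G \<alpha>"
proof -
  have "\<exists>a. a \<in> polyfun \<and> (k \<noteq> 0 \<longrightarrow> (\<forall>q\<in>polyfun. \<forall>x. G k (\<lambda>x. x $ i * q x) x = a x * G k q x))" for k i
    using coord_mult_ex[of k i] polyfun.const by (cases "k = 0") blast+
  then obtain a where a: "\<And>k i. a k i \<in> polyfun"
    "\<And>k i q x. k \<noteq> 0 \<Longrightarrow> q \<in> polyfun \<Longrightarrow> G k (\<lambda>x. x $ i * q x) x = a k i x * G k q x"
    by metis
  define \<alpha> where "\<alpha> k x = (\<chi> i. a k i x)" for k x
  have 1: "G k q x = G k (\<lambda>_. 1) x * q (\<alpha> k x)" if "k \<noteq> 0" "q \<in> polyfun" for k q x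
    using that(2)
  proof (induction rule: polyfun.induct)
    case (const c)
    show ?case using scale[OF polyfun.const[of 1], of k c x] by simp
  next
    case (add f h)
    then show ?case by (simp add: graded_lie_endo.add[OF graded_lie_endo_axioms] distrib_left)
  next
    case (coord_mult f i)
    have "G k (\<lambda>x. x $ i * f x) x = a k i x * (G k (\<lambda>_. 1) x * f (\<alpha> k x))"
      by (simp only: a(2)[OF that(1) coord_mult.hyps] coord_mult.IH)
    then show ?case by (simp add: \<alpha>_def)
  qed
  have 2: "(\<lambda>x. \<alpha> k x $ i) \<in> polyfun" for k i
    by (simp add: \<alpha>_def a)
  show ?thesis
    by (rule exI[of _ \<alpha>]) (unfold_locales, rule 2, rule 1)
qed

context graded_lie_endo_points
begin

abbreviation g where "g k \<equiv> G k (\<lambda>_. 1)"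

lemma g_poly: "g k \<in> polyfun"
  by (rule poly[OF polyfun.const])

text \<open>The image of \<open>[t\<^sup>k D\<^sub>i, t\<^bsup>-k\<^esup> D\<^sub>i] = -2 k\<^sub>i D\<^sub>i\<close>; the right side is preserved because \<open>D\<^sub>i\<close> is fixed.\<close>
lemma bracket_coord_coord:
  "- 2 * of_int (k $ i) * x $ i =
    G k (\<lambda>x. x $ i) (x - cvec k) * G (- k) (\<lambda>x. x $ i) x -
    G (- k) (\<lambda>x. x $ i) (x + cvec k) * G k (\<lambda>x. x $ i) x"
proof -
  define c :: complex where "c = - 2 * of_int (k $ i)"
  have lin: "(\<lambda>x. (x + cvec (- k)) $ i * x $ i - (x + cvec k) $ i * x $ i) = (\<lambda>x. c * x $ i)"
    by (rule ext) (simp add: c_def algebra_simps)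
  have "G 0 (\<lambda>x. c * x $ i) x = c * x $ i"
    by (subst scale[OF polyfun_coord]) (simp only: cartan)
  with bracket[OF polyfun_coord polyfun_coord, of k "- k" i i x, unfolded lin right_minus]
  show ?thesis
    unfolding c_def cvec_minus add_uminus_conv_diff by (rule trans[OF sym, rotated])
qed

lemma g_nonzero:
  assumes "k \<noteq> 0"
  shows "\<exists>x. g k x \<noteq> 0"
proof (rule ccontr)
  assume "\<not> ?thesis"
  then have zero: "G k (\<lambda>x. x $ i) x = 0" for i x
    by (subst at_point[OF assms polyfun_coord]) simp
  from assms obtain i where "k $ i \<noteq> 0" by (auto simp: vec_eq_iff)
  with bracket_coord_coord[of k i "axis i 1"] show False
    by (simp add: zero)
qed

text \<open>Cancel the nonzero polynomial \<open>g k\<close> in \<open>difference_mult\<close> for \<open>q = 1\<close>.\<close>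
lemma difference_at_point:
  assumes k: "k \<noteq> 0" and p: "p \<in> polyfun"
  shows "G 0 p (x + cvec k) - G 0 p x = p (\<alpha> k x + cvec k) - p (\<alpha> k x)"
proof -
  define d where "d x = G 0 p (x + cvec k) - G 0 p x - (p (\<alpha> k x + cvec k) - p (\<alpha> k x))" for x
  have pa: "(\<lambda>x. p (\<alpha> k x)) \<in> polyfun" "(\<lambda>x. p (\<alpha> k x + cvec k)) \<in> polyfun"
    using polyfun_subst[OF p point_poly] polyfun_subst[OF polyfun_shift[OF p] point_poly]
    by auto
  have "d \<in> polyfun"
    unfolding d_def by (intro polyfun_diff pa polyfun_shift[OF poly[OF p]] poly[OF p])
  moreover have "g k x * d x = 0" for x
  proof -
    have "G k (\<lambda>x. (p (x + cvec k) - p x) * 1) x = g k x * ((p (\<alpha> k x + cvec k) - p (\<alpha> k x)) * 1)"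
      by (rule at_point[OF k]) (intro polyfun_mult polyfun_diff polyfun_shift[OF p] p polyfun.const)
    then have "(G 0 p (x + cvec k) - G 0 p x) * g k x = g k x * (p (\<alpha> k x + cvec k) - p (\<alpha> k x))"
      using difference_mult[OF p polyfun.const[of 1], of k x] by (simp only: mult_1_right)
    then show ?thesis
      unfolding d_def by algebra
  qed
  ultimately have "\<forall>x. d x = 0"
    using polyfun_mult_eq_0[OF g_poly] g_nonzero[OF k] by blast
  then show ?thesis by (simp add: d_def)
qed

text \<open>The step from \<open>x\<close> to \<open>x + k + l\<close> can be made at once or through \<open>x + l\<close>. Comparing the increments of
  \<open>G 0 p\<close> gives a relation between six point evaluations that holds for all \<open>p\<close>.\<close>
lemma points_dichotomy_at:
  assumes nz: "k \<noteq> 0" "l \<noteq> 0" "k + l \<noteq> 0"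
  shows "(\<alpha> l x = \<alpha> (k + l) x \<and> \<alpha> k (x + cvec l) = \<alpha> l x + cvec l) \<or>
    (\<alpha> k (x + cvec l) = \<alpha> (k + l) x \<and> \<alpha> l x = \<alpha> k (x + cvec l) + cvec k)"
proof (rule point_sum_dichotomy)
  show "cvec k \<noteq> 0" "cvec l \<noteq> 0" "cvec k + cvec l \<noteq> 0"
    using nz by (auto simp flip: cvec_add)
  show "p (\<alpha> (k + l) x + cvec k + cvec l) + p (\<alpha> k (x + cvec l)) + p (\<alpha> l x) =
      p (\<alpha> (k + l) x) + p (\<alpha> k (x + cvec l) + cvec k) + p (\<alpha> l x + cvec l)"
    if "p \<in> polyfun" for p
  proof -
    have "x + cvec l + cvec k = x + cvec (k + l)"
      by (simp add: cvec_add add_ac)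
    with difference_at_point[OF nz(1) that, of "x + cvec l"]
    have "G 0 p (x + cvec (k + l)) - G 0 p (x + cvec l) = p (\<alpha> k (x + cvec l) + cvec k) - p (\<alpha> k (x + cvec l))"
      by (simp only:)
    moreover have "\<alpha> (k + l) x + cvec (k + l) = \<alpha> (k + l) x + cvec k + cvec l"
      by (simp only: cvec_add add.assoc)
    with difference_at_point[OF nz(3) that, of x]
    have "G 0 p (x + cvec (k + l)) - G 0 p x = p (\<alpha> (k + l) x + cvec k + cvec l) - p (\<alpha> (k + l) x)"
      by (simp only:)
    moreover note difference_at_point[OF nz(2) that, of x]
    ultimately show ?thesis by algebra
  qed
qed

text \<open>The choice between the alternatives does not depend on \<open>x\<close>, since each of them is an algebraic
  condition. The first one holds for translations \<open>\<alpha> k x = x + c\<close>, the second one for reflections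
  \<open>\<alpha> k x = c - x - k\<close>.\<close>
lemma points_dichotomy:
  assumes nz: "k \<noteq> 0" "l \<noteq> 0" "k + l \<noteq> 0"
  shows "(\<forall>x. \<alpha> (k + l) x = \<alpha> l x \<and> \<alpha> k (x + cvec l) = \<alpha> l x + cvec l) \<or>
    (\<forall>x. \<alpha> (k + l) x = \<alpha> k (x + cvec l) \<and> \<alpha> l x = \<alpha> k (x + cvec l) + cvec k)"
proof -
  define F where "F = range (\<lambda>i x. \<alpha> (k + l) x $ i - \<alpha> l x $ i) \<union>
    range (\<lambda>i x. \<alpha> k (x + cvec l) $ i - (\<alpha> l x $ i + cvec l $ i))"
  define H where "H = range (\<lambda>i x. \<alpha> (k + l) x $ i - \<alpha> k (x + cvec l) $ i) \<union>
    range (\<lambda>i x. \<alpha> l x $ i - (\<alpha> k (x + cvec l) $ i + cvec k $ i))"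
  have sh: "(\<lambda>x. \<alpha> k (x + cvec l) $ i) \<in> polyfun" for i
    by (rule polyfun_shift[OF point_poly])
  have F: "(\<forall>f\<in>F. f x = 0) \<longleftrightarrow> \<alpha> (k + l) x = \<alpha> l x \<and> \<alpha> k (x + cvec l) = \<alpha> l x + cvec l" for x
    by (simp only: F_def ball_Un ball_simps vec_eq_iff vector_add_component eq_iff_diff_eq_0[symmetric] UNIV_I simp_thms)
  have H: "(\<forall>h\<in>H. h x = 0) \<longleftrightarrow>
      \<alpha> (k + l) x = \<alpha> k (x + cvec l) \<and> \<alpha> l x = \<alpha> k (x + cvec l) + cvec k" for x
    by (simp only: H_def ball_Un ball_simps vec_eq_iff vector_add_component eq_iff_diff_eq_0[symmetric] UNIV_I simp_thms)
  have "F \<subseteq> polyfun"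
    unfolding F_def image_subset_iff Un_subset_iff
    by (intro conjI ballI polyfun_diff polyfun.add point_poly sh polyfun.const)
  moreover have "H \<subseteq> polyfun"
    unfolding H_def image_subset_iff Un_subset_iff
    by (intro conjI ballI polyfun_diff polyfun.add point_poly sh polyfun.const)
  ultimately have "(\<forall>x. \<forall>f\<in>F. f x = 0) \<or> (\<forall>x. \<forall>h\<in>H. h x = 0)"
  proof (rule polyfun_zero_sets_cover)
    show "(\<forall>f\<in>F. f x = 0) \<or> (\<forall>h\<in>H. h x = 0)" for x
      unfolding F H using points_dichotomy_at[OF nz, of x] by metis
  qed
  then show ?thesis
    unfolding F H .
qed

text \<open>The dichotomy is applied to \<open>(k, l)\<close> and to \<open>(l, k)\<close>. Any combination other than the first alternative
  for both contradicts the behaviour of \<open>\<alpha> k\<close> under shifts by \<open>k\<close>.\<close>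
lemma translation_type_spreads:
  assumes k: "k \<noteq> 0" and tr: "\<And>x. \<alpha> k (x + cvec k) = \<alpha> k x + cvec k"
    and l: "l \<noteq> 0" "k + l \<noteq> 0"
  shows "\<alpha> l = \<alpha> k" "\<alpha> k (x + cvec l) = \<alpha> k x + cvec l"
proof -
  have l': "l + k \<noteq> 0" using l by (simp add: add.commute)
  have kl: "cvec k \<noteq> 0" "cvec l \<noteq> 0" "cvec k + cvec k \<noteq> 0"
    using k l by (auto simp: vec_eq_iff)
  note d1 = points_dichotomy[OF k l] and d2 = points_dichotomy[OF l(1) k l']
  have comm: "x + cvec l + cvec k = x + cvec k + cvec l" for x by (simp only: add_ac)
  have kl_comm: "l + k = k + l" by (rule add.commute)
  have 1: "\<forall>x. \<alpha> (k + l) x = \<alpha> l x \<and> \<alpha> k (x + cvec l) = \<alpha> l x + cvec l"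
    using d1
  proof
    assume A: "\<forall>x. \<alpha> (k + l) x = \<alpha> k (x + cvec l) \<and> \<alpha> l x = \<alpha> k (x + cvec l) + cvec k"
    have A': "\<alpha> l (0 + cvec k) = \<alpha> k (0 + cvec l) + cvec k + cvec k"
      using A[rule_format, of "0 + cvec k"] tr[of "0 + cvec l"] by (simp only: comm)
    from d2 have False
    proof
      assume B: "\<forall>x. \<alpha> (l + k) x = \<alpha> k x \<and> \<alpha> l (x + cvec k) = \<alpha> k x + cvec k"
      then have "\<alpha> l (0 + cvec k) = \<alpha> k 0 + cvec k" "\<alpha> k (0 + cvec l) = \<alpha> k 0"
        using A[rule_format, of 0] unfolding kl_comm by metis+
      with A' kl(1) show False by simp
    next
      assume B: "\<forall>x. \<alpha> (l + k) x = \<alpha> l (x + cvec k) \<and> \<alpha> k x = \<alpha> l (x + cvec k) + cvec l"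
      then have "\<alpha> k (0 + cvec l) = \<alpha> l (0 + cvec k)"
        using A[rule_format, of 0] unfolding kl_comm by metis
      with A' kl(3) show False by (simp add: add.assoc)
    qed
    then show ?thesis ..
  qed
  have 2: "\<forall>x. \<alpha> (l + k) x = \<alpha> k x"
    using d2
  proof
    assume B: "\<forall>x. \<alpha> (l + k) x = \<alpha> l (x + cvec k) \<and> \<alpha> k x = \<alpha> l (x + cvec k) + cvec l"
    have "\<alpha> l (x + cvec k) = \<alpha> l x" for x
      using B[rule_format, of x] 1[rule_format, of x] unfolding kl_comm by metis
    then have "\<alpha> k (0 + cvec k) = \<alpha> k 0"
      using B[rule_format, of 0] B[rule_format, of "0 + cvec k"] by metis
    with tr[of 0] kl(1) have False by simp
    then show ?thesis ..
  qed blast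
  show eq: "\<alpha> l = \<alpha> k"
  proof
    show "\<alpha> l x = \<alpha> k x" for x
      using 1[rule_format, of x] 2[rule_format, of x] unfolding kl_comm by metis
  qed
  show "\<alpha> k (x + cvec l) = \<alpha> k x + cvec l"
    using 1[rule_format, of x] unfolding eq by blast
qed

text \<open>Only \<open>l = -k\<close> escapes the previous lemma, and it is reached from \<open>k + k\<close> instead of \<open>k\<close>. The map
  \<open>\<alpha> k\<close> then commutes with all shifts by integer vectors, so \<open>\<alpha> k x - x\<close> is constant.\<close>
lemma points_translation:
  assumes k: "k \<noteq> 0" and tr: "\<And>x. \<alpha> k (x + cvec k) = \<alpha> k x + cvec k"
  shows "\<exists>c. \<forall>l x. l \<noteq> 0 \<longrightarrow> \<alpha> l x = x + c"
proof -
  have kk: "k + k \<noteq> 0" "k + (k + k) \<noteq> 0" and k': "- k \<noteq> 0" "(k + k) + - k \<noteq> 0"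
    using k by (auto simp: vec_eq_iff)
  note A = translation_type_spreads[OF k tr]
  have 2: "\<alpha> (k + k) = \<alpha> k" by (rule A(1)[OF kk])
  have tr2: "\<alpha> (k + k) (x + cvec (k + k)) = \<alpha> (k + k) x + cvec (k + k)" for x
    unfolding 2 by (rule A(2)[OF kk])
  note B = translation_type_spreads[OF kk(1) tr2, of "- k", unfolded 2, OF k']
  have eq: "\<alpha> l = \<alpha> k" "\<alpha> k (x + cvec l) = \<alpha> k x + cvec l" if "l \<noteq> 0" for l x
  proof -
    have "l = - k" if "k + l = 0" using that by (simp only: add_eq_0_iff)
    then show "\<alpha> l = \<alpha> k" "\<alpha> k (x + cvec l) = \<alpha> k x + cvec l"
      using A(1)[OF \<open>l \<noteq> 0\<close>] A(2)[OF \<open>l \<noteq> 0\<close>, of x] B(1) B(2)[of x] by metis+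
  qed
  have diff0: "\<alpha> k x $ i - x $ i = \<alpha> k 0 $ i - 0 $ i" for x i
  proof (rule polyfun_lattice_invariant[of "\<lambda>x. \<alpha> k x $ i - x $ i"])
    show "(\<lambda>x. \<alpha> k x $ i - x $ i) \<in> polyfun" by (intro polyfun_diff point_poly polyfun_coord)
    show "\<alpha> k (x + cvec l) $ i - (x + cvec l) $ i = \<alpha> k x $ i - x $ i" for x l
      by (cases "l = 0") (simp_all add: eq)
  qed
  have k_eq: "\<alpha> k x = x + \<alpha> k 0" for x
  proof -
    have "\<alpha> k x $ i = x $ i + \<alpha> k 0 $ i" for i
      using diff0[of x i] by (simp only: zero_index diff_0_right diff_eq_eq add.commute)
    then show ?thesis by (simp add: vec_eq_iff)
  qed
  show ?thesis
  proof (intro exI allI impI)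
    show "\<alpha> l x = x + \<alpha> k 0" if "l \<noteq> 0" for l x
      unfolding eq(1)[OF that] by (rule k_eq)
  qed
qed

end

section \<open>Classification of the endomorphisms\<close>

lemma axis_add: "axis i (a + b) = axis i a + axis i (b :: int)"
  by (simp add: vec_eq_iff axis_def)

lemma vec_sum_axis: "m = (\<Sum>i\<in>UNIV. axis i (m $ i))" for m :: "int ^ 'n::finite"
  by (simp add: vec_eq_iff axis_def)

lemma int_lattice_hom_eq_prod:
  fixes \<gamma> :: "int ^ 'n::finite \<Rightarrow> complex"
  assumes hom: "\<And>m k. \<gamma> (m + k) = \<gamma> m * \<gamma> k" and nz: "\<And>m. \<gamma> m \<noteq> 0"
  shows "\<gamma> m = (\<Prod>i\<in>UNIV. \<gamma> (axis i 1) powi (m $ i))"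
proof -
  have one: "\<gamma> 0 = 1"
    using hom[of 0 0] nz[of 0] by simp
  have axis: "\<gamma> (axis i z) = \<gamma> (axis i 1) powi z" for i z
  proof (induction z rule: int_induct[of _ 0])
    case base
    have "axis i (0 :: int) = 0" by (simp add: vec_eq_iff axis_def)
    then show ?case by (simp only: one power_int_0_right)
  next
    case (step1 z)
    then show ?case using nz by (simp add: axis_add hom power_int_add)
  next
    case (step2 z)
    have "axis i z = axis i (z - 1) + axis i 1" by (simp flip: axis_add)
    with step2 have "\<gamma> (axis i (z - 1)) * \<gamma> (axis i 1) = \<gamma> (axis i 1) powi z"
      using hom by metis
    then have "\<gamma> (axis i (z - 1)) = \<gamma> (axis i 1) powi z / \<gamma> (axis i 1) powi 1"
      using nz[of "axis i 1"] by (simp add: eq_divide_eq)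
    then show ?case using power_int_diff[of "\<gamma> (axis i 1)" z 1] nz[of "axis i 1"] by simp
  qed
  have "\<gamma> (\<Sum>i\<in>A. axis i (m $ i)) = (\<Prod>i\<in>A. \<gamma> (axis i (m $ i)))" if "finite A" for A
    using that by (induction A rule: finite_induct) (simp_all add: one hom)
  then have "\<gamma> m = (\<Prod>i\<in>UNIV. \<gamma> (axis i (m $ i)))"
    by (subst vec_sum_axis) simp
  then show ?thesis
    by (simp only: axis[of _ "m $ _"])
qed

context graded_lie_endo
begin

lemma sum:
  "(\<And>i. i \<in> I \<Longrightarrow> f i \<in> polyfun) \<Longrightarrow> G m (\<lambda>x. \<Sum>i\<in>I. f i x) x = (\<Sum>i\<in>I. G m (f i) x)"
proof (induction I rule: infinite_finite_induct)
  case (insert i I)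
  have I: "(\<lambda>x. \<Sum>i\<in>I. f i x) \<in> polyfun"
    by (rule polyfun_sum[OF insert.prems[OF insertI2]])
  have "G m (\<lambda>x. \<Sum>i\<in>I. f i x) x = (\<Sum>i\<in>I. G m (f i) x)"
    by (rule insert.IH[OF insert.prems[OF insertI2]])
  then show ?case
    by (simp only: sum.insert[OF insert.hyps] add[OF insert.prems[OF insertI1] I])
next
  case (infinite I)
  then show ?case by (simp only: sum.infinite[OF infinite.hyps] zero)
next
  case empty
  show ?case by (simp only: sum.empty zero)
qed

text \<open>Every polynomial is a linear combination of differences in the direction \<open>i\<close>: modulo lower powers of
  \<open>x\<^sub>i\<close>, the difference of \<open>x\<^sub>i\<^bsup>a+1\<^esup> q\<close> is \<open>(a + 1) x\<^sub>i\<^sup>a q\<close> when \<open>q\<close> does not involve \<open>x\<^sub>i\<close>.\<close>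
lemma fixes_polyfun_if_fixes_differences:
  assumes differences: "\<And>p x. p \<in> polyfun \<Longrightarrow>
      G 0 (\<lambda>x. p (x + cvec (axis i 1)) - p x) x = p (x + cvec (axis i 1)) - p x"
    and p: "p \<in> polyfun"
  shows "G 0 p x = p x"
proof -
  let ?e = "cvec (axis i 1)"
  have power: "G 0 (\<lambda>x. x $ i ^ a * q x) x = x $ i ^ a * q x"
    if q: "q \<in> polyfun" "\<And>x. q (x + ?e) = q x" for a q x
  proof (induction a arbitrary: x rule: less_induct)
    case (less a)
    define r where "r = (\<lambda>x :: complex ^ 'n. \<Sum>b<a. of_nat (Suc a choose b) * (x $ i ^ b * q x))"
    have pow: "(\<lambda>x. x $ i ^ b * q x) \<in> polyfun" for b
      by (intro polyfun_mult polyfun_power polyfun_coord q)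
    have r: "r \<in> polyfun"
      unfolding r_def by (intro polyfun_sum polyfun_scale pow)
    have Gr: "G 0 r x = r x" for x
    proof -
      have "G 0 r x = (\<Sum>b<a. G 0 (\<lambda>x. of_nat (Suc a choose b) * (x $ i ^ b * q x)) x)"
        unfolding r_def by (rule sum[OF polyfun_scale[OF pow]])
      also have "\<dots> = r x"
        unfolding r_def by (intro sum.cong refl) (simp only: scale[OF pow] less.IH lessThan_iff)
      finally show ?thesis .
    qed
    have expand: "(x + ?e) $ i ^ Suc a * q (x + ?e) - x $ i ^ Suc a * q x =
        r x + of_nat (Suc a) * (x $ i ^ a * q x)" for x
    proof -
      have "(x + ?e) $ i ^ Suc a = (x $ i + 1) ^ Suc a"
        by (simp add: axis_def)
      also have "\<dots> = (\<Sum>b\<le>Suc a. of_nat (Suc a choose b) * x $ i ^ b)"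
        by (simp only: binomial_ring power_one mult_1_right)
      also have "\<dots> = (\<Sum>b<a. of_nat (Suc a choose b) * x $ i ^ b) + of_nat (Suc a) * x $ i ^ a + x $ i ^ Suc a"
        by (simp only: lessThan_Suc_atMost[symmetric] sum.lessThan_Suc binomial_Suc_n binomial_n_n
            of_nat_1 mult_1_left)
      finally have power_Suc_shift: "(x + ?e) $ i ^ Suc a =
        (\<Sum>b<a. of_nat (Suc a choose b) * x $ i ^ b) + of_nat (Suc a) * x $ i ^ a + x $ i ^ Suc a" .
      have "(\<Sum>b<a. of_nat (Suc a choose b) * x $ i ^ b) * q x = r x"
        by (simp only: r_def sum_distrib_right mult.assoc)
      then show ?thesis
        by (simp only: power_Suc_shift q(2) distrib_right add_diff_cancel_right' mult.assoc)
    qed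
    have "r x + of_nat (Suc a) * (x $ i ^ a * q x) =
        G 0 (\<lambda>x. r x + of_nat (Suc a) * (x $ i ^ a * q x)) x"
      using differences[OF pow[of "Suc a"], of x] unfolding expand ..
    also have "\<dots> = r x + of_nat (Suc a) * G 0 (\<lambda>x. x $ i ^ a * q x) x"
      by (simp only: add[OF r polyfun_scale[OF pow[of a]]] Gr scale[OF pow[of a]])
    finally have "x $ i ^ a * q x = G 0 (\<lambda>x. x $ i ^ a * q x) x"
      by (simp only: add_left_cancel mult_left_cancel[OF of_nat_neq_0])
    then show ?case ..
  qed
  \<comment> \<open>Powers of \<open>x\<^sub>i\<close> and factors free of \<open>x\<^sub>i\<close> are collected in \<open>x\<^sub>i\<^sup>a q\<close> while \<open>p\<close> is taken apart.\<close>
  have "\<forall>a q x. q \<in> polyfun \<longrightarrow> (\<forall>x. q (x + ?e) = q x) \<longrightarrow>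
      G 0 (\<lambda>x. x $ i ^ a * (q x * p x)) x = x $ i ^ a * (q x * p x)"
    using p
  proof (induction rule: polyfun.induct)
    case (const c)
    show ?case
    proof (intro allI impI)
      fix a q and x :: "complex ^ 'n" assume q: "q \<in> polyfun" "\<forall>x. q (x + ?e) = q x"
      have "q (x + ?e) * c = q x * c" for x
        by (simp only: q(2)[rule_format])
      from power[OF polyfun_mult[OF q(1) polyfun.const] this] show "G 0 (\<lambda>x. x $ i ^ a * (q x * c)) x = x $ i ^ a * (q x * c)" .
    qed
  next
    case (add f h)
    show ?case
    proof (intro allI impI)
      fix a q and x :: "complex ^ 'n" assume q: "q \<in> polyfun" "\<forall>x. q (x + ?e) = q x"
      have f: "(\<lambda>x. x $ i ^ a * (q x * f x)) \<in> polyfun" and h: "(\<lambda>x. x $ i ^ a * (q x * h x)) \<in> polyfun"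
        by (intro polyfun_mult polyfun_power polyfun_coord q(1) add.hyps)+
      show "G 0 (\<lambda>x. x $ i ^ a * (q x * (f x + h x))) x = x $ i ^ a * (q x * (f x + h x))"
        by (simp only: distrib_left graded_lie_endo.add[OF graded_lie_endo_axioms f h]
            add.IH(1)[rule_format, OF q(1) q(2)[rule_format]] add.IH(2)[rule_format, OF q(1) q(2)[rule_format]])
    qed
  next
    case (coord_mult f j)
    show ?case
    proof (intro allI impI)
      fix a q and x :: "complex ^ 'n" assume q: "q \<in> polyfun" "\<forall>x. q (x + ?e) = q x"
      show "G 0 (\<lambda>x. x $ i ^ a * (q x * (x $ j * f x))) x = x $ i ^ a * (q x * (x $ j * f x))"
      proof (cases "j = i")
        case True
        have "x $ i ^ a * (q x * (x $ j * f x)) = x $ i ^ Suc a * (q x * f x)" for x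
          by (simp add: True)
        then show ?thesis
          by (simp only: coord_mult.IH[rule_format, OF q(1) q(2)[rule_format], of "Suc a"])
      next
        case False
        have "(\<lambda>x. q x * x $ j) \<in> polyfun"
          by (intro polyfun_mult polyfun_coord q(1))
        moreover have "q (x + ?e) * (x + ?e) $ j = q x * x $ j" for x
        proof -
          have "(x + ?e) $ j = x $ j" using False by (simp add: axis_def)
          then show ?thesis by (simp only: q(2)[rule_format])
        qed
        ultimately have "G 0 (\<lambda>x. x $ i ^ a * (q x * x $ j * f x)) x = x $ i ^ a * (q x * x $ j * f x)"
          by (rule coord_mult.IH[rule_format])
        then show ?thesis
          by (simp only: mult.assoc)
      qed
    qed
  qed
  from this[rule_format, OF polyfun.const[of 1] refl, of 0 x] show ?thesis
    by (simp only: power_0 mult_1_left)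
qed

end

context graded_lie_endo_points
begin

text \<open>The bracket of \<open>t\<^sup>k D\<^sub>i\<close> and \<open>t\<^bsup>-k\<^esup> D\<^sub>i\<close>, evaluated where \<open>x\<^sub>i + c\<^sub>i\<close> vanishes, forces \<open>c = 0\<close>; together with
  \<open>[t\<^sup>k, t\<^bsup>-k\<^esup>] = 0\<close> it makes the symbols of the images of \<open>t\<^sup>k\<close> and \<open>t\<^bsup>-k\<^esup>\<close> mutually inverse
  up to a shift, hence constant. These constants
  are multiplicative by \<open>[t\<^sup>m D\<^sub>i, t\<^sup>k] = k\<^sub>i t\<^bsup>m+k\<^esup>\<close>. Brackets of \<open>t\<^bsup>-k\<^esup> q(D)\<close> with \<open>t\<^sup>k\<close> are differences of
  \<open>q\<close>, which settles degree 0.\<close>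
lemma translation_classification:
  assumes points: "\<forall>k x. k \<noteq> 0 \<longrightarrow> \<alpha> k x = x + c"
  shows "\<exists>\<Lambda>. (\<forall>i. \<Lambda> $ i \<noteq> 0) \<and>
    (\<forall>m p x. p \<in> polyfun \<longrightarrow> G m p x = (\<Prod>i\<in>UNIV. (\<Lambda> $ i) powi (m $ i)) * p x)"
proof -
  have one: "(\<lambda>_. 1) \<in> polyfun" by (rule polyfun.const)
  have G_c: "G k q x = g k x * q (x + c)" if "k \<noteq> 0" "q \<in> polyfun" for k q x
    using at_point[OF that, of x] points[rule_format, OF that(1), of x] by (simp only:)
  have "c $ i = 0" for i
  proof -
    \<comment> \<open>At \<open>x = -c\<close> both products on the right of \<open>bracket_coord_coord\<close> contain the factor \<open>x\<^sub>i + c\<^sub>i\<close>.\<close>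
    have k: "axis i 1 \<noteq> (0 :: int ^ 'n)" "- axis i 1 \<noteq> (0 :: int ^ 'n)" by (simp_all add: vec_eq_iff axis_def)
    show ?thesis
      using bracket_coord_coord[of "axis i 1" i "- c"]
      by (simp only: G_c[OF k(1) polyfun_coord] G_c[OF k(2) polyfun_coord]) simp
  qed
  then have "c = 0" by (simp add: vec_eq_iff)
  with G_c have G_g: "G k q x = g k x * q x" if "k \<noteq> 0" "q \<in> polyfun" for k q x
    using that by (simp only: add_0_right)
  have inverse: "g k (x - cvec k) * g (- k) x = 1" if k: "k \<noteq> 0" for k x
  proof -
    have k': "- k \<noteq> 0" using k by simp
    obtain i where i: "k $ i \<noteq> 0" using k by (auto simp: vec_eq_iff)
    define h where "h x = g k (x - cvec k) * g (- k) x" for x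
    have comm: "h x = g (- k) (x + cvec k) * g k x" for x
      using bracket[OF one one, of k "- k" x] by (simp add: cvec_minus zero h_def)
    have zero: "x $ i * (h x - 1) = 0" for x
    proof -
      have "G k (\<lambda>x. x $ i) (x - cvec k) * G (- k) (\<lambda>x. x $ i) x = h x * ((x $ i - of_int (k $ i)) * x $ i)"
        by (simp only: G_g[OF k polyfun_coord] G_g[OF k' polyfun_coord] h_def
            vector_minus_component cvec_nth mult_ac)
      moreover have "G (- k) (\<lambda>x. x $ i) (x + cvec k) * G k (\<lambda>x. x $ i) x = h x * ((x $ i + of_int (k $ i)) * x $ i)"
        by (simp only: G_g[OF k polyfun_coord] G_g[OF k' polyfun_coord] comm
            vector_add_component cvec_nth mult_ac)
      ultimately have "- 2 * of_int (k $ i) * x $ i =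
          h x * ((x $ i - of_int (k $ i)) * x $ i) - h x * ((x $ i + of_int (k $ i)) * x $ i)"
        using bracket_coord_coord[of k i x] by (simp only:)
      then have "(2 * of_int (k $ i)) * (x $ i * (h x - 1)) = 0" by algebra
      then show ?thesis using i by simp
    qed
    have h: "h \<in> polyfun"
      unfolding h_def by (intro polyfun_mult polyfun_shift_diff[OF g_poly] g_poly)
    have "(\<forall>x :: complex ^ 'n. x $ i = 0) \<or> (\<forall>x. h x - 1 = 0)"
    proof (rule polyfun_mult_eq_0[OF polyfun_coord])
      show "(\<lambda>x. h x - 1) \<in> polyfun" by (rule polyfun_diff[OF h one])
    qed (rule zero)
    moreover have "(axis i 1 :: complex ^ 'n) $ i \<noteq> 0" by simp
    ultimately show ?thesis unfolding h_def by (metis eq_iff_diff_eq_0)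
  qed
  have g_const: "g k x = g k 0" if "k \<noteq> 0" for k x
    using polyfun_unit_const[OF polyfun_shift_diff[OF g_poly] g_poly inverse[OF that],
        of "x + cvec k" "cvec k"] by simp
  define \<gamma> where "\<gamma> k = (if k = 0 then 1 else g k 0)" for k
  have G_\<gamma>: "G k q x = \<gamma> k * q x" if "k \<noteq> 0" "q \<in> polyfun" for k q x
    using G_g[OF that] g_const[OF that(1), of x] that by (simp only: \<gamma>_def if_False)
  have inv: "\<gamma> k * \<gamma> (- k) = 1" if "k \<noteq> 0" for k
    using inverse[OF that, of 0] g_const[OF that, of "0 - cvec k"] that by (simp only: \<gamma>_def if_False neg_equal_0_iff_equal)
  have nz: "\<gamma> k \<noteq> 0" for k
    using inv[of k] by (cases "k = 0") (auto simp: \<gamma>_def)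
  have hom: "\<gamma> (m + k) = \<gamma> m * \<gamma> k" for m k
  proof (cases "m = 0 \<or> k = 0 \<or> m + k = 0")
    case True
    moreover have ?thesis if "m + k = 0" "m \<noteq> 0"
    proof -
      from that have "k = - m" by (simp only: add_eq_0_iff)
      with inv[OF that(2)] show ?thesis by (simp add: \<gamma>_def)
    qed
    ultimately show ?thesis by (auto simp: \<gamma>_def)
  next
    case False
    then have mk: "m \<noteq> 0" "k \<noteq> 0" "m + k \<noteq> 0" by auto
    obtain i where i: "k $ i \<noteq> 0" using mk by (auto simp: vec_eq_iff)
    have "(\<lambda>x. (x + cvec k) $ i * 1 - 1 * x $ i) = (\<lambda>_. of_int (k $ i))"
      by (simp add: fun_eq_iff)
    with bracket[OF polyfun_coord[of i] one, of m k 0]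
    have "G (m + k) (\<lambda>_. of_int (k $ i)) 0 =
        G m (\<lambda>x. x $ i) (0 + cvec k) * G k (\<lambda>_. 1) 0 - G k (\<lambda>_. 1) (0 + cvec m) * G m (\<lambda>x. x $ i) 0"
      by (simp only:)
    then have "\<gamma> (m + k) * of_int (k $ i) = \<gamma> m * of_int (k $ i) * \<gamma> k"
      by (simp only: G_\<gamma>[OF mk(1) polyfun_coord] G_\<gamma>[OF mk(2) one] G_\<gamma>[OF mk(3) polyfun.const]) simp
    with i show ?thesis by simp
  qed
  have fix0: "G 0 p x = p x" if p: "p \<in> polyfun" for p x
  proof (rule fixes_polyfun_if_fixes_differences[OF _ p])
    fix q and x :: "complex ^ 'n" assume q: "(q :: complex ^ 'n \<Rightarrow> complex) \<in> polyfun"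
    define k :: "int ^ 'n" where "k = axis undefined 1"
    have k: "k \<noteq> 0" "- k \<noteq> 0" by (simp_all add: k_def vec_eq_iff axis_def)
    have "G 0 (\<lambda>x. q (x + cvec k) - q x) x = \<gamma> (- k) * \<gamma> k * (q (x + cvec k) - q x)"
      using bracket[OF q one, of "- k" k x]
      by (simp only: G_\<gamma>[OF k(2) q] G_\<gamma>[OF k(1) one] left_minus mult_1_right mult_1_left) (simp add: algebra_simps)
    also have "\<gamma> (- k) * \<gamma> k = 1" using inv[OF k(1)] by (simp only: mult.commute)
    finally show "G 0 (\<lambda>x. q (x + cvec (axis undefined 1)) - q x) x = q (x + cvec (axis undefined 1)) - q x"
      by (simp only: k_def mult_1_left)
  qed
  have "G m p x = (\<Prod>i\<in>UNIV. ((\<chi> i. \<gamma> (axis i 1)) $ i) powi (m $ i)) * p x"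
    if p: "p \<in> polyfun" for m p x
  proof (cases "m = 0")
    case True
    then show ?thesis by (simp add: fix0[OF p])
  next
    case False
    show ?thesis
      unfolding G_\<gamma>[OF False p] int_lattice_hom_eq_prod[OF hom nz, of m] by simp
  qed
  then show ?thesis
    by (intro exI[of _ "\<chi> i. \<gamma> (axis i 1)"]) (simp add: nz)
qed

end

text \<open>The dichotomy for a single pair \<open>(k, k)\<close> decides. If it gives a reflection, composing with the Lie
  algebra endomorphism \<open>t\<^sup>m p(D) \<mapsto> - t\<^sup>m p(-D - m)\<close>, the negative of the anti-automorphism that fixes the
  \<open>t\<^sub>i\<close> and negates the \<open>D\<^sub>i\<close>, turns it into a translation.\<close>
theorem (in graded_lie_endo) classification:
  "\<exists>\<Lambda>. (\<forall>i. \<Lambda> $ i \<noteq> 0) \<and>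
    ((\<forall>m p x. p \<in> polyfun \<longrightarrow> G m p x = (\<Prod>i\<in>UNIV. (\<Lambda> $ i) powi (m $ i)) * p x) \<or>
     (\<forall>m p x. p \<in> polyfun \<longrightarrow> G m p x = - (\<Prod>i\<in>UNIV. (\<Lambda> $ i) powi (m $ i)) * p (- x - cvec m)))"
proof -
  obtain \<alpha> where "graded_lie_endo_points G \<alpha>"
    using eval_points_ex by blast
  then interpret P: graded_lie_endo_points G \<alpha> .
  define k :: "int ^ 'n" where "k = axis undefined 1"
  have k: "k \<noteq> 0" "k + k \<noteq> 0" by (simp_all add: k_def vec_eq_iff axis_def)
  from P.points_dichotomy[OF k(1) k(1) k(2)] show ?thesis
  proof
    assume "\<forall>x. \<alpha> (k + k) x = \<alpha> k x \<and> \<alpha> k (x + cvec k) = \<alpha> k x + cvec k"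
    then have "\<alpha> k (x + cvec k) = \<alpha> k x + cvec k" for x by blast
    then obtain c where "\<forall>l x. l \<noteq> 0 \<longrightarrow> \<alpha> l x = x + c"
      using P.points_translation[OF k(1)] by blast
    from P.translation_classification[OF this] show ?thesis by blast
  next
    assume refl: "\<forall>x. \<alpha> (k + k) x = \<alpha> k (x + cvec k) \<and> \<alpha> k x = \<alpha> k (x + cvec k) + cvec k"
    define \<theta> :: "int ^ 'n \<Rightarrow> (complex ^ 'n \<Rightarrow> complex) \<Rightarrow> complex ^ 'n \<Rightarrow> complex"
      where "\<theta> m p x = - p (- x - cvec m)" for m p x
    have \<theta>_poly: "\<theta> m p \<in> polyfun" if "p \<in> polyfun" for m p
      using polyfun_uminus[OF polyfun_reflect[OF that]] by (simp add: \<theta>_def[abs_def])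
    define G' where "G' m p = G m (\<theta> m p)" for m p
    define \<alpha>' where "\<alpha>' k x = - \<alpha> k x - cvec k" for k x
    interpret G': graded_lie_endo G'
    proof
      fix p q :: "complex ^ 'n \<Rightarrow> complex" and m l :: "int ^ 'n" and x :: "complex ^ 'n" and c i
      show "G' 0 (\<lambda>x. x $ i) x = x $ i"
      proof -
        have "\<theta> 0 (\<lambda>x. x $ i) = (\<lambda>x. x $ i)" by (simp add: \<theta>_def fun_eq_iff)
        then show ?thesis by (simp only: G'_def cartan)
      qed
      assume p: "p \<in> polyfun"
      show "G' m p \<in> polyfun"
        unfolding G'_def by (intro poly \<theta>_poly p)
      have "\<theta> m (\<lambda>x. c * p x) = (\<lambda>x. c * \<theta> m p x)"
        by (simp add: \<theta>_def fun_eq_iff)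
      then show "G' m (\<lambda>x. c * p x) x = c * G' m p x"
        by (simp only: G'_def scale[OF \<theta>_poly[OF p]])
      assume q: "q \<in> polyfun"
      have "\<theta> m (\<lambda>x. p x + q x) = (\<lambda>x. \<theta> m p x + \<theta> m q x)"
        by (simp add: \<theta>_def fun_eq_iff)
      then show "G' m (\<lambda>x. p x + q x) x = G' m p x + G' m q x"
        by (simp only: G'_def add[OF \<theta>_poly[OF p] \<theta>_poly[OF q]])
      have "\<theta> (m + l) (\<lambda>x. p (x + cvec l) * q x - q (x + cvec m) * p x) =
          (\<lambda>x. \<theta> m p (x + cvec l) * \<theta> l q x - \<theta> l q (x + cvec m) * \<theta> m p x)"
        by (simp add: \<theta>_def fun_eq_iff cvec_add algebra_simps)
      then show "G' (m + l) (\<lambda>x. p (x + cvec l) * q x - q (x + cvec m) * p x) x =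
          G' m p (x + cvec l) * G' l q x - G' l q (x + cvec m) * G' m p x"
        by (simp only: G'_def bracket[OF \<theta>_poly[OF p] \<theta>_poly[OF q]])
    qed
    interpret P': graded_lie_endo_points G' \<alpha>'
    proof
      show "(\<lambda>x. \<alpha>' k x $ i) \<in> polyfun" for k i
        unfolding \<alpha>'_def vector_minus_component vector_uminus_component
        by (intro polyfun_diff polyfun_uminus P.point_poly polyfun.const)
      show "G' k q x = G' k (\<lambda>_. 1) x * q (\<alpha>' k x)" if "k \<noteq> 0" "q \<in> polyfun" for k q x
        unfolding G'_def P.at_point[OF that(1) \<theta>_poly[OF that(2)]]
          P.at_point[OF that(1) \<theta>_poly[OF polyfun.const]] by (simp add: \<theta>_def \<alpha>'_def)
    qed
    have "\<alpha>' k (x + cvec k) = \<alpha>' k x + cvec k" for x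
    proof -
      have "\<alpha> k x = \<alpha> k (x + cvec k) + cvec k" using refl by blast
      then show ?thesis unfolding \<alpha>'_def by (simp add: algebra_simps)
    qed
    then obtain c where "\<forall>l x. l \<noteq> 0 \<longrightarrow> \<alpha>' l x = x + c"
      using P'.points_translation[OF k(1)] by blast
    from P'.translation_classification[OF this] obtain \<Lambda> where \<Lambda>: "\<forall>i. \<Lambda> $ i \<noteq> 0"
      "\<And>m p x. p \<in> polyfun \<Longrightarrow> G' m p x = (\<Prod>i\<in>UNIV. (\<Lambda> $ i) powi (m $ i)) * p x"
      by blast
    have "G m p x = - (\<Prod>i\<in>UNIV. (\<Lambda> $ i) powi (m $ i)) * p (- x - cvec m)"
      if p: "p \<in> polyfun" for m p x
    proof -
      have "\<theta> m (\<theta> m p) = p" by (simp add: \<theta>_def fun_eq_iff)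
      then have "G m p x = G' m (\<theta> m p) x" by (simp only: G'_def)
      also have "\<dots> = (\<Prod>i\<in>UNIV. (\<Lambda> $ i) powi (m $ i)) * \<theta> m p x"
        by (rule \<Lambda>(2)[OF \<theta>_poly[OF p]])
      finally show ?thesis by (simp add: \<theta>_def)
    qed
    with \<Lambda>(1) show ?thesis by blast
  qed
qed

section \<open>The operators \<open>t\<^sup>m p(D)\<close>\<close>

text \<open>The operator \<open>t\<^sup>m p(D)\<close>: it sends \<open>t\<^sup>k\<close> to \<open>p(k) t\<^bsup>k+m\<^esup>\<close>.\<close>
definition weyl_op :: "int ^ 'n::finite \<Rightarrow> (complex ^ 'n \<Rightarrow> complex) \<Rightarrow> 'n laurent_op" where
  "weyl_op m p f = (\<Sum>k\<in>Poly_Mapping.keys f.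
    Poly_Mapping.single (k + m) (p (cvec k) * Poly_Mapping.lookup f k))"

lemma lookup_weyl_op:
  "Poly_Mapping.lookup (weyl_op m p f) k = p (cvec (k - m)) * Poly_Mapping.lookup f (k - m)"
proof -
  have "Poly_Mapping.lookup (weyl_op m p f) k =
      (\<Sum>l\<in>Poly_Mapping.keys f. if l = k - m then p (cvec l) * Poly_Mapping.lookup f l else 0)"
    by (auto simp: weyl_op_def lookup_sum lookup_single when_def algebra_simps intro!: sum.cong)
  then show ?thesis
    by (auto simp: in_keys_iff)
qed

lemma diff_monom_eq_weyl_op: "diff_monom m n = weyl_op m (\<lambda>x. \<Prod>i\<in>UNIV. x $ i ^ (n $ i))"
  by (intro ext poly_mapping_eqI) (simp add: lookup_diff_monom lookup_weyl_op)

lemma euler_eq_weyl_op: "euler i = weyl_op 0 (\<lambda>x. x $ i)"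
  by (intro ext poly_mapping_eqI) (simp add: lookup_euler lookup_weyl_op)

lemma weyl_op_add: "weyl_op m (\<lambda>x. p x + q x) = weyl_op m p + weyl_op m q"
  by (intro ext poly_mapping_eqI) (simp add: lookup_weyl_op lookup_add distrib_right)

lemma weyl_op_scale: "weyl_op m (\<lambda>x. c * p x) = op_scale c (weyl_op m p)"
  by (intro ext poly_mapping_eqI) (simp add: lookup_weyl_op op_scale_def)

lemma weyl_op_in_diff_ops:
  assumes "p \<in> polyfun"
  shows "weyl_op m p \<in> diff_ops"
proof -
  obtain P where P: "p = eval P"
    using assms range_eval by blast
  have "weyl_op m p = (\<Sum>n\<in>Poly_Mapping.keys P. op_scale (Poly_Mapping.lookup P n) (diff_monom m n))"
    by (intro ext poly_mapping_eqI)
      (simp add: P lookup_weyl_op eval_def sum_fun_apply lookup_sum op_scale_def lookup_diff_monom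
        sum_distrib_right mult.assoc)
  also have "\<dots> \<in> diff_ops"
    by (intro laurent_op.subspace_sum laurent_op.subspace_scale subspace_diff_ops diff_monom_in)
  finally show ?thesis .
qed

lemma commutator_weyl_op:
  "commutator (weyl_op m p) (weyl_op k q) =
    weyl_op (m + k) (\<lambda>x. p (x + cvec k) * q x - q (x + cvec m) * p x)"
proof (intro ext poly_mapping_eqI)
  fix f j
  have "cvec (j - (m + k)) + cvec k = cvec (j - m)" "cvec (j - (m + k)) + cvec m = cvec (j - k)"
    by (simp_all add: vec_eq_iff)
  moreover have "j - m - k = j - (m + k)" "j - k - m = j - (m + k)"
    by simp_all
  ultimately show "Poly_Mapping.lookup (commutator (weyl_op m p) (weyl_op k q) f) j = Poly_Mapping.lookup
      (weyl_op (m + k) (\<lambda>x. p (x + cvec k) * q x - q (x + cvec m) * p x) f) j"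
    by (simp only: commutator_def minus_apply comp_apply lookup_minus lookup_weyl_op
        left_diff_distrib mult.assoc)
qed

lemma commutator_euler_weyl_op:
  "commutator (euler i) (weyl_op m p) = op_scale (of_int (m $ i)) (weyl_op m p)"
proof -
  have "(\<lambda>x. (x + cvec m) $ i * p x - p (x + cvec 0) * x $ i) = (\<lambda>x. of_int (m $ i) * p x)"
    by (simp add: fun_eq_iff algebra_simps)
  then show ?thesis
    by (simp only: euler_eq_weyl_op commutator_weyl_op weyl_op_scale add_0_left)
qed

lemma euler_in_cartan: "euler i \<in> cartan"
  unfolding cartan_def by (rule laurent_op.span_base) simp

section \<open>Modules free of rank one over the Cartan subalgebra\<close>

lemma lie_module_restrict:
  assumes "lie_module smul \<gg> bracket scaleM act" "lie_algebra smul \<hh> bracket" "\<hh> \<subseteq> \<gg>"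
  shows "lie_module smul \<hh> bracket scaleM act"
proof -
  interpret g: lie_module smul \<gg> bracket scaleM act by fact
  interpret h: lie_algebra smul \<hh> bracket by fact
  show ?thesis
    by unfold_locales
      (use assms(3) in \<open>simp_all add: subset_iff g.act_add_left g.act_scale_left g.act_add_right g.act_scale_right g.act_bracket\<close>)
qed

lemma lie_module_laurent: "lie_module op_scale diff_ops commutator pm_scale (\<lambda>P f. P f)"
proof -
  interpret lie_algebra op_scale diff_ops commutator by (rule lie_algebra_diff_ops)
  show ?thesis
    by unfold_locales (auto simp: diff_ops_linear op_scale_def commutator_def)
qed

lemma funpow_commute_apply:
  assumes "\<And>x. f (g x) = g (f x)"
  shows "(f ^^ a) ((g ^^ b) x) = (g ^^ b) ((f ^^ a) x)"
proof -
  have "f ((g ^^ b) x) = (g ^^ b) (f x)" for x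
    by (induction b) (simp_all add: assms)
  then show ?thesis
    by (induction a) simp_all
qed

text \<open>Here \<open>v\<close> is a free generator over the enveloping algebra of the Cartan subalgebra.\<close>
locale free_cartan_module = lie_module op_scale diff_ops commutator scaleM act
  for scaleM :: "complex \<Rightarrow> 'm::ab_group_add \<Rightarrow> 'm"
    and act :: "'n::finite laurent_op \<Rightarrow> 'm \<Rightarrow> 'm" +
  fixes v :: 'm
  assumes bij: "bij_betw (\<lambda>u. uea_act scaleM act u v) (uea op_scale cartan commutator) UNIV"
begin

sublocale cartan: lie_module op_scale cartan commutator scaleM act
  by (rule lie_module_restrict[OF lie_module_axioms lie_algebra_cartan cartan_subset])

definition uea_class :: "('n laurent_op word \<Rightarrow>\<^sub>0 complex) \<Rightarrow> ('n laurent_op word \<Rightarrow>\<^sub>0 complex) set" where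
  "uea_class p = {q. p \<in> free_alg cartan \<and> q \<in> free_alg cartan \<and>
    p - q \<in> uea_ideal op_scale cartan commutator}"

lemma uea_eq: "uea op_scale cartan commutator = uea_class ` free_alg cartan"
  unfolding uea_def quotient_def uea_class_def by blast

lemma in_uea_class: "p \<in> free_alg cartan \<Longrightarrow> p \<in> uea_class p"
  by (simp add: uea_class_def uea_ideal.zero)

lemma uea_act_uea_class:
  assumes "p \<in> free_alg cartan"
  shows "uea_act scaleM act (uea_class p) v = free_act scaleM act p v"
  by (rule cartan.uea_act_class[OF _ in_uea_class[OF assms]]) (simp add: uea_eq assms)

lemma generated: "\<exists>p\<in>free_alg cartan. w = free_act scaleM act p v"
proof -
  have "w \<in> (\<lambda>u. uea_act scaleM act u v) ` uea_class ` free_alg cartan"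
    using bij by (simp add: bij_betw_def uea_eq)
  then show ?thesis by (auto simp: uea_act_uea_class)
qed

text \<open>The class of \<open>p\<close> acts on \<open>v\<close> like the class of 0, and classes are determined by this action.\<close>
lemma free:
  assumes p: "p \<in> free_alg cartan" and zero: "free_act scaleM act p v = 0"
  shows "p \<in> uea_ideal op_scale cartan commutator"
proof -
  have 0: "0 \<in> free_alg cartan" by (simp add: free_alg_def)
  have "uea_act scaleM act (uea_class p) v = uea_act scaleM act (uea_class 0) v"
    by (simp add: uea_act_uea_class p 0 zero cartan.free_act_zero)
  then have "uea_class p = uea_class 0"
    using bij p 0 unfolding bij_betw_def uea_eq inj_on_def by blast
  then have "0 \<in> uea_class p" using in_uea_class[OF 0] by simp
  then show ?thesis by (simp add: uea_class_def)
qed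

lemma euler_in: "euler i \<in> diff_ops"
  using euler_in_cartan cartan_subset by blast

lemma act_zero_left: "act 0 w = 0"
proof -
  have "act (op_scale 0 (euler undefined)) w = scaleM 0 (act (euler undefined) w)"
    by (rule act_scale_left[OF euler_in])
  then show ?thesis by simp
qed

lemma act_euler_commute: "act (euler i) (act (euler j) w) = act (euler j) (act (euler i) w)"
  using act_bracket[OF euler_in euler_in, of i j w]
  by (simp add: cartan_abelian euler_in_cartan act_zero_left)

text \<open>The product of the powers of \<open>D\<^sub>i\<close> with exponent \<open>n $ i\<close> over \<open>i \<in> A\<close>, applied to \<open>v\<close>. The index set \<open>A\<close> allows induction on it; the
  case of interest is \<open>A = UNIV\<close>.\<close>
definition D_pow_on :: "'n set \<Rightarrow> nat ^ 'n \<Rightarrow> 'm" where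
  "D_pow_on A n = Finite_Set.fold (\<lambda>i. act (euler i) ^^ (n $ i)) v A"

lemma D_pow_on_insert:
  assumes "i \<notin> A"
  shows "D_pow_on (insert i A) n = (act (euler i) ^^ (n $ i)) (D_pow_on A n)"
proof -
  interpret comp_fun_commute "\<lambda>i. act (euler i) ^^ (n $ i)"
    by standard (rule ext, unfold comp_apply, rule funpow_commute_apply, rule act_euler_commute)
  show ?thesis
    unfolding D_pow_on_def using assms by (simp add: finite_subset[OF subset_UNIV])
qed

lemma D_pow_on_empty: "D_pow_on {} n = v"
  by (simp add: D_pow_on_def)

lemma D_pow_on_0: "D_pow_on A 0 = v"
  using finite[of A] by (induction A rule: finite_induct) (simp_all add: D_pow_on_empty D_pow_on_insert)

lemma D_pow_on_add_axis:
  "D_pow_on A (axis i 1 + n) = (if i \<in> A then act (euler i) (D_pow_on A n) else D_pow_on A n)"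
  using finite[of A]
proof (induction A rule: finite_induct)
  case empty
  show ?case by (simp add: D_pow_on_empty)
next
  case (insert a A)
  have pow: "(act (euler a) ^^ b) (act (euler i) w) = act (euler i) ((act (euler a) ^^ b) w)" for b w
    using funpow_commute_apply[of "act (euler a)" "act (euler i)" b 1 w, OF act_euler_commute] by simp
  show ?case
  proof (cases "a = i")
    case True
    with insert show ?thesis by (simp add: D_pow_on_insert)
  next
    case False
    then have "(axis i 1 + n) $ a = n $ a" by (simp add: axis_def)
    with False insert show ?thesis by (simp add: D_pow_on_insert pow)
  qed
qed

text \<open>The element \<open>p(D) v\<close>.\<close>
definition of_mpoly :: "'n mpoly \<Rightarrow> 'm" where
  "of_mpoly p = (\<Sum>n\<in>Poly_Mapping.keys p. scaleM (Poly_Mapping.lookup p n) (D_pow_on UNIV n))"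

lemma of_mpoly_superset:
  assumes "finite S" "Poly_Mapping.keys p \<subseteq> S"
  shows "of_mpoly p = (\<Sum>n\<in>S. scaleM (Poly_Mapping.lookup p n) (D_pow_on UNIV n))"
  unfolding of_mpoly_def using assms
  by (intro sum.mono_neutral_left) (auto simp: in_keys_iff)

lemma of_mpoly_single: "of_mpoly (Poly_Mapping.single n c) = scaleM c (D_pow_on UNIV n)"
  by (cases "c = 0") (auto simp: of_mpoly_def)

lemma of_mpoly_add: "of_mpoly (p + q) = of_mpoly p + of_mpoly q"
proof -
  let ?S = "Poly_Mapping.keys p \<union> Poly_Mapping.keys q"
  have "Poly_Mapping.keys (p + q) \<subseteq> ?S"
    by (rule Poly_Mapping.keys_add)
  then show ?thesis
    by (subst (1 2 3) of_mpoly_superset[of ?S])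
      (auto simp: lookup_add M.scale_left_distrib sum.distrib)
qed

lemma of_mpoly_scale: "of_mpoly (pm_scale c p) = scaleM c (of_mpoly p)"
proof -
  have "Poly_Mapping.keys (pm_scale c p) \<subseteq> Poly_Mapping.keys p"
    by (auto simp: in_keys_iff)
  then show ?thesis
    by (subst of_mpoly_superset[of "Poly_Mapping.keys p"])
      (auto simp: of_mpoly_def M.scale_sum_right)
qed

lemma of_mpoly_zero: "of_mpoly 0 = 0"
  by (simp add: of_mpoly_def)

lemma of_mpoly_sum: "of_mpoly (\<Sum>i\<in>I. f i) = (\<Sum>i\<in>I. of_mpoly (f i))"
  by (induction I rule: infinite_finite_induct) (auto simp: of_mpoly_add of_mpoly_zero)

lemma of_mpoly_mconst: "of_mpoly (mconst c) = scaleM c v"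
  by (simp add: mconst_def of_mpoly_single D_pow_on_0)

lemma act_sum_right: "P \<in> diff_ops \<Longrightarrow> act P (\<Sum>i\<in>I. f i) = (\<Sum>i\<in>I. act P (f i))"
  using foldr_act_sum[of "[P]" f I] by simp

lemma of_mpoly_mvar_mult: "of_mpoly (mvar i * p) = act (euler i) (of_mpoly p)"
proof -
  have "mvar i * p = (\<Sum>n\<in>Poly_Mapping.keys p. Poly_Mapping.single (axis i 1 + n) (Poly_Mapping.lookup p n))"
    by (subst pm_expand[of p]) (simp add: mvar_def sum_distrib_left mult_single)
  then show ?thesis
    by (simp add: of_mpoly_sum of_mpoly_single D_pow_on_add_axis of_mpoly_def[of p]
        act_sum_right euler_in act_scale_right del: One_nat_def)
qed

text \<open>The same element of the free algebra is used on \<open>M\<close>, where it produces \<open>p(D) v\<close>, and on Laurent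
  polynomials, where it multiplies \<open>t\<^sup>k\<close> by \<open>p(k)\<close>.\<close>
lemma lift_mpoly:
  "\<exists>P\<in>free_alg cartan. free_act scaleM act P v = of_mpoly p \<and>
    (\<forall>k. free_act pm_scale (\<lambda>P f. P f) P (laurent_monom k) =
      pm_scale (eval p (cvec k)) (laurent_monom k))"
proof -
  interpret nat: lie_module op_scale "cartan :: 'n laurent_op set" commutator pm_scale "\<lambda>P f. P f"
    by (rule lie_module_restrict[OF lie_module_laurent lie_algebra_cartan cartan_subset])
  show ?thesis
  proof (induction p rule: mpoly_induct)
    case (const c)
    have "Poly_Mapping.single 0 c \<in> free_alg (cartan :: 'n laurent_op set)"
      by (auto simp: free_alg_def zero_word_def split: if_splits)
    then show ?case
      by (intro bexI[of _ "Poly_Mapping.single 0 c"])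
        (simp_all add: cartan.free_act_single nat.free_act_single of_mpoly_mconst zero_word_def)
  next
    case (add p q)
    then obtain P Q where "P \<in> free_alg cartan" "Q \<in> free_alg cartan"
      "free_act scaleM act P v = of_mpoly p" "free_act scaleM act Q v = of_mpoly q"
      "\<And>k. free_act pm_scale (\<lambda>P f. P f) P (laurent_monom k) = pm_scale (eval p (cvec k)) (laurent_monom k)"
      "\<And>k. free_act pm_scale (\<lambda>P f. P f) Q (laurent_monom k) = pm_scale (eval q (cvec k)) (laurent_monom k)"
      by blast
    then show ?case
      by (intro bexI[of _ "P + Q"])
        (simp_all add: cartan.free_act_add nat.free_act_add of_mpoly_add pm.scale_left_distrib free_alg_add)
  next
    case (mvar_mult i p)
    then obtain P where P: "P \<in> free_alg cartan" "free_act scaleM act P v = of_mpoly p"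
      "\<And>k. free_act pm_scale (\<lambda>P f. P f) P (laurent_monom k) = pm_scale (eval p (cvec k)) (laurent_monom k)"
      by blast
    have "euler i (pm_scale c (laurent_monom k)) = pm_scale (of_int (k $ i) * c) (laurent_monom k)" for c k
      by (rule poly_mapping_eqI) (simp add: lookup_euler laurent_monom_def lookup_single when_def)
    with P show ?case
      by (intro bexI[of _ "gen (euler i) * P"])
        (simp_all add: cartan.free_act_mult nat.free_act_mult cartan.free_act_gen nat.free_act_gen
          free_alg_gen free_alg_mult euler_in_cartan of_mpoly_mvar_mult)
  qed
qed

text \<open>A lift of \<open>p\<close> that annihilates \<open>v\<close> lies in the ideal of relations and so acts as zero on every module.
  On Laurent polynomials this says that \<open>p\<close> vanishes at all integer points.\<close>
lemma of_mpoly_eq_0: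
  assumes "of_mpoly p = 0"
  shows "p = 0"
proof (rule eval_eq_0_on_ints)
  fix k
  interpret nat: lie_module op_scale "cartan :: 'n laurent_op set" commutator pm_scale "\<lambda>P f. P f"
    by (rule lie_module_restrict[OF lie_module_laurent lie_algebra_cartan cartan_subset])
  obtain P where P: "P \<in> free_alg cartan" "free_act scaleM act P v = of_mpoly p"
    "\<And>k. free_act pm_scale (\<lambda>P f. P f) P (laurent_monom k) = pm_scale (eval p (cvec k)) (laurent_monom k)"
    using lift_mpoly by blast
  have "P \<in> uea_ideal op_scale cartan commutator"
    using P assms by (intro free) simp_all
  from nat.uea_ideal_acts_zero[OF this, of "laurent_monom k"]
  have "pm_scale (eval p (cvec k)) (laurent_monom k) = 0"
    by (simp only: P)
  then have "Poly_Mapping.lookup (pm_scale (eval p (cvec k)) (laurent_monom k)) k = 0"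
    by (simp only: lookup_zero)
  then show "eval p (cvec k) = 0"
    by (simp add: laurent_monom_def)
qed

text \<open>The elements \<open>p(D) v\<close> contain \<open>v\<close> and form a subspace stable under the Cartan subalgebra, hence
  contain everything that words in it produce from \<open>v\<close>.\<close>
lemma range_of_mpoly: "w \<in> range of_mpoly"
proof -
  have add: "a + b \<in> range of_mpoly" if "a \<in> range of_mpoly" "b \<in> range of_mpoly" for a b
    using that by (auto simp flip: of_mpoly_add)
  have scale: "scaleM c a \<in> range of_mpoly" if "a \<in> range of_mpoly" for c a
    using that by (auto simp flip: of_mpoly_scale)
  have cartan: "act P a \<in> range of_mpoly" if "P \<in> cartan" "a \<in> range of_mpoly" for P a
  proof -
    have "P \<in> cartan \<and> act P a \<in> range of_mpoly"
      using that(1) unfolding cartan_def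
    proof (induction rule: laurent_op.span_induct_alt)
      case base
      show ?case using act_zero_left[of a] of_mpoly_zero laurent_op.span_zero by (metis rangeI)
    next
      case (step c x y)
      then obtain i where x: "x = euler i" by blast
      have cx: "op_scale c x \<in> cartan"
        unfolding cartan_def x by (intro laurent_op.span_scale laurent_op.span_base) simp
      have y: "y \<in> cartan" using step by (simp add: cartan_def)
      have "act (op_scale c x + y) a = scaleM c (act (euler i) a) + act y a"
        unfolding cartan.act_add_left[OF cx y] unfolding x
        by (simp only: cartan.act_scale_left[OF euler_in_cartan])
      moreover have "act (euler i) a \<in> range of_mpoly"
        using that(2) by (auto simp flip: of_mpoly_mvar_mult)
      ultimately have "act (op_scale c x + y) a \<in> range of_mpoly"
        using step by (simp only: add scale)
      moreover have "op_scale c x + y \<in> cartan"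
        using cx y unfolding cartan_def by (rule laurent_op.span_add)
      ultimately show ?case unfolding cartan_def by blast
    qed
    then show ?thesis ..
  qed
  have word: "foldr act ws v \<in> range of_mpoly" if "set ws \<subseteq> cartan" for ws
    using that
  proof (induction ws)
    case Nil
    have "v = of_mpoly (mconst 1)" by (simp add: of_mpoly_mconst)
    then show ?case by simp
  qed (simp add: cartan)
  obtain p where p: "p \<in> free_alg cartan" "w = free_act scaleM act p v"
    using generated by blast
  have "(\<Sum>u\<in>I. scaleM (Poly_Mapping.lookup p u) (foldr act (letters u) v)) \<in> range of_mpoly"
    if "I \<subseteq> Poly_Mapping.keys p" for I
    using finite_subset[OF that finite_keys] that
  proof (induction I rule: finite_induct)
    case empty
    show ?case using rangeI[of of_mpoly 0] by (simp only: sum.empty of_mpoly_zero)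
  next
    case (insert u I)
    then have u: "set (letters u) \<subseteq> cartan"
      using p(1) by (simp add: free_alg_def)
    have I: "(\<Sum>u\<in>I. scaleM (Poly_Mapping.lookup p u) (foldr act (letters u) v)) \<in> range of_mpoly"
      using insert.prems by (intro insert.IH) simp
    show ?case
      unfolding sum.insert[OF insert.hyps] by (rule add[OF scale[OF word[OF u]] I])
  qed
  then show ?thesis
    by (simp add: p(2) free_act_def)
qed

lemma bij_of_mpoly: "bij of_mpoly"
proof (rule bijI)
  show "inj of_mpoly"
  proof
    fix p q assume eq: "of_mpoly p = of_mpoly q"
    have "of_mpoly ((p - q) + q) = of_mpoly (p - q) + of_mpoly q" by (rule of_mpoly_add)
    with eq have "of_mpoly (p - q) = 0" by simp
    then show "p = q" using of_mpoly_eq_0 by fastforce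
  qed
  show "surj of_mpoly" using range_of_mpoly by blast
qed

definition to_mpoly :: "'m \<Rightarrow> 'n mpoly" where
  "to_mpoly = inv of_mpoly"

lemma to_of_mpoly [simp]: "to_mpoly (of_mpoly p) = p"
  by (simp add: to_mpoly_def bij_is_inj[OF bij_of_mpoly])

lemma of_to_mpoly [simp]: "of_mpoly (to_mpoly w) = w"
  by (simp add: to_mpoly_def surj_f_inv_f[OF bij_is_surj[OF bij_of_mpoly]])

lemma to_mpoly_eqI: "of_mpoly p = w \<Longrightarrow> to_mpoly w = p"
  by auto

text \<open>The polynomial function by which an element of \<open>M\<close> is represented.\<close>
definition fn :: "'m \<Rightarrow> complex ^ 'n \<Rightarrow> complex" where
  "fn w = eval (to_mpoly w)"

lemma fn_polyfun: "fn w \<in> polyfun"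
  by (simp add: fn_def eval_polyfun)

lemma to_mpoly_add: "to_mpoly (a + b) = to_mpoly a + to_mpoly b"
  by (rule to_mpoly_eqI) (simp add: of_mpoly_add)

lemma to_mpoly_scale: "to_mpoly (scaleM c a) = pm_scale c (to_mpoly a)"
  by (rule to_mpoly_eqI) (simp add: of_mpoly_scale)

lemma fn_add: "fn (a + b) x = fn a x + fn b x"
  by (simp add: fn_def to_mpoly_add)

lemma fn_scale: "fn (scaleM c a) x = c * fn a x"
  by (simp add: fn_def to_mpoly_scale)

lemma fn_diff: "fn (a - b) x = fn a x - fn b x"
  using fn_add[of "a - b" b x] by simp

lemma fn_v: "fn v x = 1"
proof -
  have "to_mpoly v = mconst 1" by (rule to_mpoly_eqI) (simp add: of_mpoly_mconst)
  then show ?thesis by (simp add: fn_def)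
qed

lemma fn_act_euler: "fn (act (euler i) w) x = x $ i * fn w x"
proof -
  have "to_mpoly (act (euler i) w) = mvar i * to_mpoly w"
    by (rule to_mpoly_eqI) (simp add: of_mpoly_mvar_mult)
  then show ?thesis by (simp add: fn_def)
qed

text \<open>Since \<open>[D\<^sub>i, t\<^sup>m p(D)] = m\<^sub>i t\<^sup>m p(D)\<close>, the operator \<open>t\<^sup>m p(D)\<close> intertwines multiplication by \<open>x\<^sub>i\<close> with
  multiplication by \<open>x\<^sub>i - m\<^sub>i\<close>. It is therefore determined by its value on \<open>v\<close>.\<close>
lemma fn_act_weyl_op:
  assumes p: "p \<in> polyfun"
  shows "fn (act (weyl_op m p) w) (x + cvec m) = fn (act (weyl_op m p) v) (x + cvec m) * fn w x"
proof -
  have P: "weyl_op m p \<in> diff_ops" by (rule weyl_op_in_diff_ops[OF p])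
  have "fn (act (weyl_op m p) (of_mpoly q)) (x + cvec m) =
      fn (act (weyl_op m p) v) (x + cvec m) * eval q x" for q
  proof (induction q rule: mpoly_induct)
    case (const c)
    show ?case by (simp add: of_mpoly_mconst act_scale_right[OF P] fn_scale)
  next
    case (add q r)
    then show ?case by (simp add: of_mpoly_add act_add_right[OF P] fn_add distrib_left)
  next
    case (mvar_mult i q)
    let ?w = "of_mpoly q"
    have "scaleM (of_int (m $ i)) (act (weyl_op m p) ?w) =
        act (euler i) (act (weyl_op m p) ?w) - act (weyl_op m p) (act (euler i) ?w)"
      using act_bracket[OF euler_in P, of i ?w]
      by (simp add: commutator_euler_weyl_op act_scale_left[OF P])
    then have "fn (scaleM (of_int (m $ i)) (act (weyl_op m p) ?w)) (x + cvec m) =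
        fn (act (euler i) (act (weyl_op m p) ?w) - act (weyl_op m p) (act (euler i) ?w)) (x + cvec m)"
      by simp
    then have "of_int (m $ i) * fn (act (weyl_op m p) ?w) (x + cvec m) =
        (x $ i + of_int (m $ i)) * fn (act (weyl_op m p) ?w) (x + cvec m) -
        fn (act (weyl_op m p) (act (euler i) ?w)) (x + cvec m)"
      by (simp add: fn_scale fn_diff fn_act_euler)
    then have "fn (act (weyl_op m p) (act (euler i) ?w)) (x + cvec m) =
        x $ i * fn (act (weyl_op m p) ?w) (x + cvec m)"
      by algebra
    then show ?case
      by (simp add: of_mpoly_mvar_mult mvar_mult.IH)
  qed
  from this[of "to_mpoly w"] show ?thesis by (simp add: fn_def)
qed

section \<open>The module structure\<close>

text \<open>The shift by \<open>m\<close> makes \<open>t\<^sup>m p(D)\<close> act on \<open>M\<close> in the way \<open>t\<^sup>m q(D)\<close> acts on Laurent polynomials, with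
  \<open>q = symbol m p\<close>.\<close>
definition symbol :: "int ^ 'n \<Rightarrow> (complex ^ 'n \<Rightarrow> complex) \<Rightarrow> complex ^ 'n \<Rightarrow> complex" where
  "symbol m p x = fn (act (weyl_op m p) v) (x + cvec m)"

lemma fn_act_symbol:
  assumes "p \<in> polyfun"
  shows "fn (act (weyl_op m p) w) (x + cvec m) = symbol m p x * fn w x"
  unfolding symbol_def by (rule fn_act_weyl_op[OF assms])

lemma fn_act_euler_v: "fn (act (weyl_op 0 (\<lambda>x. x $ i)) v) x = x $ i"
  by (simp add: fn_act_euler fn_v flip: euler_eq_weyl_op)

sublocale symbol: graded_lie_endo symbol
proof
  fix p q :: "complex ^ 'n \<Rightarrow> complex" and m k :: "int ^ 'n" and x :: "complex ^ 'n" and c i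
  show "symbol 0 (\<lambda>x. x $ i) x = x $ i"
    by (simp add: symbol_def fn_act_euler_v)
  assume p: "p \<in> polyfun"
  have P: "weyl_op m p \<in> diff_ops" by (rule weyl_op_in_diff_ops[OF p])
  show "symbol m p \<in> polyfun"
    using polyfun_shift[OF fn_polyfun] by (simp add: symbol_def[abs_def])
  show "symbol m (\<lambda>x. c * p x) x = c * symbol m p x"
    by (simp add: symbol_def weyl_op_scale act_scale_left[OF P] fn_scale)
  assume q: "q \<in> polyfun"
  show "symbol m (\<lambda>x. p x + q x) x = symbol m p x + symbol m q x"
    by (simp add: symbol_def weyl_op_add act_add_left[OF P weyl_op_in_diff_ops[OF q]] fn_add)
  have Q: "weyl_op k q \<in> diff_ops" by (rule weyl_op_in_diff_ops[OF q])
  have mk: "x + cvec (m + k) = x + cvec k + cvec m" "x + cvec k + cvec m = x + cvec m + cvec k"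
    by (simp_all only: cvec_add add_ac)
  have "symbol (m + k) (\<lambda>x. p (x + cvec k) * q x - q (x + cvec m) * p x) x =
      fn (act (commutator (weyl_op m p) (weyl_op k q)) v) (x + cvec (m + k))"
    by (simp only: symbol_def commutator_weyl_op)
  also have "\<dots> = fn (act (weyl_op m p) (act (weyl_op k q) v)) (x + cvec (m + k)) -
      fn (act (weyl_op k q) (act (weyl_op m p) v)) (x + cvec (m + k))"
    by (simp only: act_bracket[OF P Q] fn_diff)
  also have "fn (act (weyl_op m p) (act (weyl_op k q) v)) (x + cvec (m + k)) =
      symbol m p (x + cvec k) * symbol k q x"
    unfolding mk(1) fn_act_symbol[OF p] symbol_def[of k q] ..
  also have "fn (act (weyl_op k q) (act (weyl_op m p) v)) (x + cvec (m + k)) =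
      symbol k q (x + cvec m) * symbol m p x"
    unfolding mk(1) mk(2) fn_act_symbol[OF q] symbol_def[of m p] ..
  finally show "symbol (m + k) (\<lambda>x. p (x + cvec k) * q x - q (x + cvec m) * p x) x =
      symbol m p (x + cvec k) * symbol k q x - symbol k q (x + cvec m) * symbol m p x" .
qed

lemma eval_omega_monom:
  "eval (omega_monom \<Lambda> \<epsilon> m n f) x =
    ((-1) ^ (1 - \<epsilon>)) powi (1 - (\<Sum>i\<in>UNIV. int (n $ i))) * (\<Prod>i\<in>UNIV. (\<Lambda> $ i) powi (m $ i)) *
      ((\<Prod>j\<in>UNIV. (x $ j - of_nat \<epsilon> * of_int (m $ j)) ^ (n $ j)) * eval f (x - cvec m))"
proof -
  have "(\<chi> i. eval (mvar i - mconst (of_int (m $ i))) x) = x - cvec m"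
    by (simp add: vec_eq_iff)
  then show ?thesis
    by (simp add: omega_monom_def eval_msubst)
qed

text \<open>The two cases of the classification of \<open>symbol\<close> are \<open>\<epsilon> = 1\<close> and \<open>\<epsilon> = 0\<close>. In the second one,
  \<open>p(-x - m)\<close> is evaluated at \<open>x - m\<close>, and reflecting a monomial of degree \<open>d\<close> produces the sign
  \<open>(-1)\<^sup>d\<close>.\<close>
lemma diff_monom_acts_as_omega_monom:
  "\<exists>(\<Lambda> :: complex ^ 'n) (\<epsilon> :: nat). (\<forall>i. \<Lambda> $ i \<noteq> 0) \<and> \<epsilon> \<in> {0, 1} \<and>
    (\<forall>m n w. to_mpoly (act (diff_monom m n) w) = omega_monom \<Lambda> \<epsilon> m n (to_mpoly w))"
proof -
  have mon: "(\<lambda>x. \<Prod>i\<in>UNIV. x $ i ^ (n $ i)) \<in> polyfun" for n :: "nat ^ 'n"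
    by (intro polyfun_prod polyfun_power polyfun_coord)
  have fn_mon: "fn (act (diff_monom m n) w) x =
      symbol m (\<lambda>x. \<Prod>i\<in>UNIV. x $ i ^ (n $ i)) (x - cvec m) * fn w (x - cvec m)" for m n w x
    using fn_act_symbol[OF mon, of m n w "x - cvec m"] by (simp add: diff_monom_eq_weyl_op)
  obtain \<Lambda> where nz: "\<forall>i. \<Lambda> $ i \<noteq> 0"
    and cases: "(\<forall>m p x. p \<in> polyfun \<longrightarrow> symbol m p x = (\<Prod>i\<in>UNIV. (\<Lambda> $ i) powi (m $ i)) * p x) \<or>
     (\<forall>m p x. p \<in> polyfun \<longrightarrow> symbol m p x = - (\<Prod>i\<in>UNIV. (\<Lambda> $ i) powi (m $ i)) * p (- x - cvec m))"
    using symbol.classification by blast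
  from cases show ?thesis
  proof
    assume S: "\<forall>m p x. p \<in> polyfun \<longrightarrow> symbol m p x = (\<Prod>i\<in>UNIV. (\<Lambda> $ i) powi (m $ i)) * p x"
    have "to_mpoly (act (diff_monom m n) w) = omega_monom \<Lambda> 1 m n (to_mpoly w)" for m n w
    proof (rule injD[OF inj_eval], rule ext)
      show "eval (to_mpoly (act (diff_monom m n) w)) x = eval (omega_monom \<Lambda> 1 m n (to_mpoly w)) x" for x
        using fn_mon[of m n w x] unfolding fn_def S[rule_format, OF mon] eval_omega_monom
        by (simp add: mult.assoc)
    qed
    with nz show ?thesis by (intro exI[of _ \<Lambda>] exI[of _ 1]) simp
  next
    assume S: "\<forall>m p x. p \<in> polyfun \<longrightarrow> symbol m p x = - (\<Prod>i\<in>UNIV. (\<Lambda> $ i) powi (m $ i)) * p (- x - cvec m)"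
    have "to_mpoly (act (diff_monom m n) w) = omega_monom \<Lambda> 0 m n (to_mpoly w)" for m n w
    proof (rule injD[OF inj_eval], rule ext)
      fix x :: "complex ^ 'n"
      have "(-1 :: complex) powi (1 - int k) = - ((-1) ^ k)" for k
        by (cases "even k") (simp_all add: power_int_diff)
      then have sign: "(-1 :: complex) powi (1 - (\<Sum>i\<in>UNIV. int (n $ i))) = - ((-1) ^ (\<Sum>i\<in>UNIV. n $ i))"
        by (simp flip: of_nat_sum)
      have "(\<Prod>i\<in>UNIV. (- (x $ i)) ^ (n $ i)) = (-1) ^ (\<Sum>i\<in>UNIV. n $ i) * (\<Prod>i\<in>UNIV. x $ i ^ (n $ i))"
        by (simp only: power_minus[of "x $ i" for i] prod.distrib power_sum)
      with fn_mon[of m n w x]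
      show "eval (to_mpoly (act (diff_monom m n) w)) x = eval (omega_monom \<Lambda> 0 m n (to_mpoly w)) x"
        unfolding fn_def S[rule_format, OF mon] eval_omega_monom by (simp add: sign mult_ac)
    qed
    with nz show ?thesis by (intro exI[of _ \<Lambda>] exI[of _ 0]) simp
  qed
qed

lemma act_sum_left:
  assumes "finite S" "S \<subseteq> diff_ops"
  shows "act (\<Sum>P\<in>S. op_scale (c P) P) w = (\<Sum>P\<in>S. scaleM (c P) (act P w))"
  using assms
proof (induction S rule: finite_induct)
  case empty
  show ?case by (simp only: sum.empty act_zero_left)
next
  case (insert P S)
  then have P: "P \<in> diff_ops" and S: "S \<subseteq> diff_ops" by simp_all
  have cP: "op_scale (c P) P \<in> diff_ops"
    by (rule laurent_op.subspace_scale[OF subspace_diff_ops P])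
  have sum: "(\<Sum>P\<in>S. op_scale (c P) P) \<in> diff_ops"
    using S by (intro laurent_op.subspace_sum laurent_op.subspace_scale subspace_diff_ops) blast
  show ?case
    by (simp only: sum.insert[OF insert.hyps] act_add_left[OF cP sum] act_scale_left[OF P] insert.IH[OF S])
qed

lemma to_mpoly_sum: "to_mpoly (\<Sum>i\<in>I. f i) = (\<Sum>i\<in>I. to_mpoly (f i))"
  by (rule to_mpoly_eqI) (simp add: of_mpoly_sum)

text \<open>Expand \<open>P\<close> in the basis of differential monomials.\<close>
lemma to_mpoly_act_omega:
  assumes monom: "\<And>m n w. to_mpoly (act (diff_monom m n) w) = omega_monom \<Lambda> \<epsilon> m n (to_mpoly w)"
    and P: "P \<in> diff_ops"
  shows "to_mpoly (act P w) = omega \<Lambda> \<epsilon> P (to_mpoly w)"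
proof -
  define c where "c = laurent_op.representation diff_monoms P"
  define h :: "(int ^ 'n) \<times> (nat ^ 'n) \<Rightarrow> 'n laurent_op" where "h = (\<lambda>(m, n). diff_monom m n)"
  define S where "S = {Q. c Q \<noteq> 0}"
  have fin: "finite S"
    unfolding S_def c_def by (rule laurent_op.finite_representation)
  have S_sub: "S \<subseteq> diff_monoms"
    unfolding S_def c_def using laurent_op.representation_ne_zero by blast
  then have S_diff: "S \<subseteq> diff_ops"
    by (auto simp: diff_monoms_def diff_monom_in)
  have S_eq: "S = h ` {(m, n). c (diff_monom m n) \<noteq> 0}"
    using S_sub by (auto simp: S_def h_def diff_monoms_def)
  have inj: "inj_on h A" for A
    by (auto simp: inj_on_def h_def inj_diff_monom)
  have "(\<Sum>Q\<in>S. op_scale (c Q) Q) = P"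
    unfolding S_def c_def
    by (rule laurent_op.sum_nonzero_representation_eq[OF independent_diff_monoms])
      (use P in \<open>simp add: diff_ops_def\<close>)
  then have "to_mpoly (act P w) = to_mpoly (act (\<Sum>Q\<in>S. op_scale (c Q) Q) w)"
    by (simp only:)
  also have "\<dots> = (\<Sum>Q\<in>S. pm_scale (c Q) (to_mpoly (act Q w)))"
    by (simp only: act_sum_left[OF fin S_diff] to_mpoly_sum to_mpoly_scale)
  also have "\<dots> = (\<Sum>(m, n) | c (diff_monom m n) \<noteq> 0.
      pm_scale (c (diff_monom m n)) (omega_monom \<Lambda> \<epsilon> m n (to_mpoly w)))"
    unfolding S_eq sum.reindex[OF inj] by (rule sum.cong) (auto simp: h_def monom)
  finally show ?thesis
    by (simp add: omega_def c_def)
qed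

end

theorem theorem5p4:
  fixes scaleM :: "complex \<Rightarrow> 'm::ab_group_add \<Rightarrow> 'm"
    and act :: "'n::finite laurent_op \<Rightarrow> 'm \<Rightarrow> 'm"
  assumes "lie_module op_scale diff_ops commutator scaleM act"
    and "uea_free_rank_one op_scale cartan commutator scaleM act"
  shows "\<exists>(\<Lambda> :: complex ^ 'n) (\<epsilon> :: nat). (\<forall>i. \<Lambda> $ i \<noteq> 0) \<and> \<epsilon> \<in> {0, 1} \<and>
    lie_module_isomorphic diff_ops scaleM act pm_scale (omega \<Lambda> \<epsilon>)"
proof -
  obtain v where "bij_betw (\<lambda>u. uea_act scaleM act u v) (uea op_scale cartan commutator) UNIV"
    using assms(2) by (auto simp: uea_free_rank_one_def)
  then interpret free_cartan_module scaleM act v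
    using assms(1) by (intro free_cartan_module.intro free_cartan_module_axioms.intro)
  obtain \<Lambda> \<epsilon> where \<Lambda>: "\<forall>i. \<Lambda> $ i \<noteq> 0" "\<epsilon> \<in> {0, 1}"
    and monom: "\<And>m n w. to_mpoly (act (diff_monom m n) w) = omega_monom \<Lambda> \<epsilon> m n (to_mpoly w)"
    using diff_monom_acts_as_omega_monom by blast
  have "Vector_Spaces.linear scaleM pm_scale to_mpoly"
    by unfold_locales (rule to_mpoly_add to_mpoly_scale)+
  moreover have "bij to_mpoly"
    unfolding to_mpoly_def by (rule bij_imp_bij_inv[OF bij_of_mpoly])
  ultimately have "lie_module_isomorphic diff_ops scaleM act pm_scale (omega \<Lambda> \<epsilon>)"
    unfolding lie_module_isomorphic_def using to_mpoly_act_omega[OF monom] by blast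
  with \<Lambda> show ?thesis by blast
qed

end
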